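(* For every positive even integer $t$, $$\sum_{\lambda\in \mathcal{SC}}q^{|\lambda|}x^{|\mathcal{H}_t(\lambda)|}b^{\mathrm{BG}(\lambda)}= \frac{\left(q^{2t};q^{2t}\right)_{\infty}^{t/2}}{\left(x^2q^{2t};x^2q^{2t}\right)_\infty^{t/2}}\left(-bq;q^4\right)_{\infty}\left(-q^3/b;q^4\right)_{\infty}.$$
   Context: A partition is a finite nonincreasing sequence $\lambda=(\lambda_1,\dots,\lambda_\ell)$ of positive integers (the empty partition is allowed), and $|\lambda|$ is the sum of its parts. A partition is identified with its Ferrers diagram, the set of boxes $(i,j)$ (row $i$, column $j$) with $1\le j\le\lambda_i$. The conjugate $\lambda'$ is given by $\lambda'_j=\#\{i:\lambda_i\ge j\}$; $\mathcal{SC}$ is the set of self-conjugate partitions ($\lambda=\lambda'$). The hook-length of a box $(i,j)$ is $\lambda_i-j+\lambda'_j-i+1$; $\mathcal{H}_t(\lambda)$ is the multiset of hook-lengths of $\lambda$ divisible by $t$, with cardinality counted with multiplicity. The BG-rank is $\mathrm{BG}(\lambda)=\sum_{(i,j)\in\lambda}(-1)^{i+j}$. Also $(a;q)_\infty=\prod_{j\ge0}(1-aq^j)$. The identity is one of formal power series in $q$ whose coefficients are polynomials in $x,b,b^{-1}$. *)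

theory Defs
  imports
    "HOL-Analysis.Analysis"
    "HOL-Library.Poly_Mapping"
    "HOL-Library.Multiset"
    "HOL-Computational_Algebra.Formal_Power_Series"
    "HOL-Computational_Algebra.Polynomial"
begin

section \<open>Partitions\<close>

definition is_partition :: "nat list \<Rightarrow> bool" where
  "is_partition l \<longleftrightarrow> sorted_wrt (\<ge>) l \<and> (\<forall>p\<in>set l. 0 < p)"

text \<open>Rows and columns are numbered from 1; \<open>part l i\<close> is 0 beyond the last part.\<close>

definition part :: "nat list \<Rightarrow> nat \<Rightarrow> nat" where
  "part l i = (if 1 \<le> i \<and> i \<le> length l then l ! (i - 1) else 0)"

definition ferrers :: "nat list \<Rightarrow> (nat \<times> nat) set" where
  "ferrers l = {(i, j). 1 \<le> i \<and> i \<le> length l \<and> 1 \<le> j \<and> j \<le> part l i}"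

definition conj_part :: "nat list \<Rightarrow> nat \<Rightarrow> nat" where
  "conj_part l j = card {i. 1 \<le> i \<and> i \<le> length l \<and> j \<le> part l i}"

definition conjugate :: "nat list \<Rightarrow> nat list" where
  "conjugate l = map (conj_part l) [1..<part l 1 + 1]"

definition self_conjugate :: "nat list set" where
  "self_conjugate = {l. is_partition l \<and> conjugate l = l}"

text \<open>On boxes \<open>(i, j)\<close> of the diagram of \<open>l\<close> no subtraction below is truncated.\<close>

definition hook :: "nat list \<Rightarrow> nat \<times> nat \<Rightarrow> nat" where
  "hook l = (\<lambda>(i, j). part l i - j + conj_part l j - i + 1)"

definition hooks_div :: "nat \<Rightarrow> nat list \<Rightarrow> nat multiset" where
  "hooks_div t l = {#h \<in># image_mset (hook l) (mset_set (ferrers l)). t dvd h#}"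

definition BG_rank :: "nat list \<Rightarrow> int" where
  "BG_rank l = (\<Sum>(i, j)\<in>ferrers l. (-1) ^ (i + j))"


section \<open>The ring of power series in q over \<open>\<int>[b, 1/b][x]\<close>\<close>

text \<open>\<open>int \<Rightarrow>\<^sub>0 int\<close>, with convolution as product, is the ring of Laurent polynomials in \<open>b\<close>;
  \<open>b_pow m\<close> is the monomial with exponent \<open>m\<close>.\<close>

type_synonym coeffs = "(int \<Rightarrow>\<^sub>0 int) poly"

definition q_var :: "coeffs fps" where "q_var = fps_X"

definition x_var :: "coeffs fps" where "x_var = fps_const [:0, 1:]"

definition b_pow :: "int \<Rightarrow> coeffs fps" where
  "b_pow m = fps_const [:Poly_Mapping.single m 1:]"

lemma b_pow_0: "b_pow 0 = 1"
  by (simp only: b_pow_def single_one one_pCons [symmetric] fps_const_1_eq_1)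

lemma b_pow_add: "b_pow (m + n) = b_pow m * b_pow n"
  by (simp add: b_pow_def mult_single add.commute)

text \<open>The product converges in the topology of formal power series when \<open>y\<close> has constant
  coefficient 0.\<close>

definition qpoch_inf :: "coeffs fps \<Rightarrow> coeffs fps \<Rightarrow> coeffs fps" where
  "qpoch_inf a y = prodinf (\<lambda>j. 1 - a * y ^ j)"

text \<open>The coefficients do not form a field, so a series with constant coefficient 1 is inverted
  by the one-sided inverse of the library, which takes the inverse of that coefficient as an
  argument.\<close>

definition recip :: "coeffs fps \<Rightarrow> coeffs fps" where
  "recip f = fps_right_inverse f 1"

lemma mult_recip:
  assumes "fps_nth f 0 = 1"
  shows "f * recip f = 1"
  using assms by (simp add: recip_def fps_right_inverse)

lemma qpoch_inf_LIMSEQ: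
  assumes a: "fps_nth a 0 = 0" and y: "fps_nth y 0 = 0"
  shows "(\<lambda>n. \<Prod>j\<le>n. 1 - a * y ^ j) \<longlonglongrightarrow> qpoch_inf a y"
    and "fps_nth (qpoch_inf a y) 0 = 1"
proof -
  define P where "P n = (\<Prod>j\<le>n. 1 - a * y ^ j)" for n
  have low: "fps_nth (g * y ^ m) k = 0" if "k < m" for g :: "coeffs fps" and k m
  proof -
    have "fps_nth (y ^ m) i = 0" if "i < m" for i
      using startsby_zero_power_prefix[OF y] that by blast
    with that show ?thesis by (simp add: fps_mult_nth)
  qed
  have step: "fps_nth (P (Suc n)) k = fps_nth (P n) k" if "k \<le> n" for n k
  proof -
    have "P (Suc n) = P n - (P n * a) * y ^ Suc n"
      unfolding P_def by (simp add: algebra_simps)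
    moreover have "fps_nth ((P n * a) * y ^ Suc n) k = 0"
      using low that by (meson le_imp_less_Suc)
    ultimately show ?thesis by (metis diff_zero fps_sub_nth)
  qed
  have stable: "fps_nth (P n) k = fps_nth (P k) k" if "k \<le> n" for n k
    using that by (induction n rule: dec_induct) (auto simp: step)
  define L where "L = Abs_fps (\<lambda>k. fps_nth (P k) k)"
  have lim: "P \<longlonglongrightarrow> L"
  proof (rule tendsto_fpsI)
    fix k
    show "\<forall>\<^sub>F n in sequentially. fps_nth (P n) k = fps_nth L k"
      unfolding eventually_sequentially L_def fps_nth_Abs_fps using stable by blast
  qed
  have L0: "fps_nth L 0 = 1"
    using a by (simp add: L_def P_def)
  then have "L \<noteq> 0" by auto
  with lim have "(\<lambda>j. 1 - a * y ^ j) has_prod L"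
    by (simp add: has_prod_def raw_has_prod_def P_def [abs_def])
  then have "qpoch_inf a y = L"
    unfolding qpoch_inf_def by (metis has_prod_unique)
  with lim L0 show "(\<lambda>n. \<Prod>j\<le>n. 1 - a * y ^ j) \<longlonglongrightarrow> qpoch_inf a y"
    "fps_nth (qpoch_inf a y) 0 = 1"
    by (simp_all add: P_def [abs_def])
qed

end

(*
  Encode a partition by its beta-set B = {lambda_i + n - i | 1 <= i <= n}, with n = t N.  It is
  self-conjugate iff x |-> 2n - 1 - x swaps B with its complement in {0..<2n}, and the hooks of
  length divisible by t are the inversions of the t runners {s | t s + r in B}.  Runner t - 1 - r
  is the mirrored complement of runner r, so for even t the runners with r < t/2 are arbitrary
  subsets of {0..<2N} and the generating function truncated at length n is a product over them.
  Grouping the subsets by cardinality gives in each factor Gaussian binomials in y = x^2 q^(2t),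
  which after multiplication by (y; y)_oo tend to 1.  Hence G(x) (x^2 q^(2t); x^2 q^(2t))_oo^(t/2)
  does not depend on x, and at x = 1 the sum over B factors into the two products in b.
*)
theory Submission
  imports Defs
begin

subsection \<open>Beta-sets of partitions\<close>

text \<open>The evenness of t is used twice. No residue r equals its mirror t - 1 - r, so no runner
  is constrained by itself; and t s + r has the parity of r, so the BG-rank is the alternating sum
  of the charges (cardinality minus N) of the runners below t/2. A runner and its mirror have
  equally many inversions, which is why x enters only through x^2 and y carries q^(2t) instead of
  q^t. The delicate point is the limit. The Gaussian binomial counting k beads on 2N places is close
  to 1/(y; y)_oo only if k is far from both 0 and 2N. For the other k the charge k - N is large, and
  the quadratic power of q attached to it makes the term negligible.
  \<open>charge_energy_bound\<close> adds up the two effects, so that one precision q^N serves all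
  k. Infinite sums and products enter only through truncations modulo q^N.\<close>

lemma part_antimono:
  assumes "is_partition l" "1 \<le> i" "i \<le> k"
  shows "part l k \<le> part l i"
proof (cases "k \<le> length l \<and> i < k")
  case True
  have "l ! (k - 1) \<le> l ! (i - 1)"
    using assms True unfolding is_partition_def by (auto simp: sorted_wrt_iff_nth_less)
  with True assms show ?thesis by (simp add: part_def)
next
  case False
  with assms show ?thesis by (cases "i = k") (auto simp: part_def)
qed

lemma part_pos_iff:
  assumes "is_partition l" "1 \<le> i"
  shows "0 < part l i \<longleftrightarrow> i \<le> length l"
proof -
  have "0 < l ! (i - 1)" if "i \<le> length l"
    using assms that unfolding is_partition_def by auto
  then show ?thesis using assms by (auto simp: part_def)
qed

text \<open>Since the parts decrease, every column of the diagram is an initial segment of rows;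
  comparing cardinalities with {1..i} and {1..<i} gives the two directions.\<close>

lemma le_part_iff_le_conj_part:
  assumes l: "is_partition l" and i: "1 \<le> i" and j: "1 \<le> j"
  shows "j \<le> part l i \<longleftrightarrow> i \<le> conj_part l j"
proof -
  define A where "A = {i. 1 \<le> i \<and> i \<le> length l \<and> j \<le> part l i}"
  have fin: "finite A" by (rule finite_subset[of _ "{..length l}"]) (auto simp: A_def)
  have c: "conj_part l j = card A" by (simp add: conj_part_def A_def)
  show ?thesis
  proof
    assume "j \<le> part l i"
    then have "{1..i} \<subseteq> A"
      using part_antimono[OF l] part_pos_iff[OF l] j unfolding A_def
      by (smt (verit) atLeastAtMost_iff le_trans mem_Collect_eq subsetI less_le_trans zero_less_one)
    from card_mono[OF fin this] show "i \<le> conj_part l j" by (simp add: c)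
  next
    assume a: "i \<le> conj_part l j"
    show "j \<le> part l i"
    proof (rule ccontr)
      assume "\<not> j \<le> part l i"
      then have "A \<subseteq> {1..<i}"
        using part_antimono[OF l i] unfolding A_def by (auto simp: not_le) (meson leI le_trans not_le)
      from card_mono[OF _ this] have "card A \<le> i - 1" by simp
      with a i show False by (simp add: c)
    qed
  qed
qed

lemma conj_part_le_length: "conj_part l j \<le> length l"
proof -
  have "card {i. 1 \<le> i \<and> i \<le> length l \<and> j \<le> part l i} \<le> card {1..length l}"
    by (intro card_mono) auto
  then show ?thesis by (simp add: conj_part_def)
qed

lemma conj_part_antimono: "j \<le> k \<Longrightarrow> conj_part l k \<le> conj_part l j"
  unfolding conj_part_def by (intro card_mono) auto

lemma conj_part_1:
  assumes "is_partition l"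
  shows "conj_part l 1 = length l"
proof -
  have "{i. 1 \<le> i \<and> i \<le> length l \<and> 1 \<le> part l i} = {1..length l}"
    using part_pos_iff[OF assms] by (auto simp: Suc_le_eq)
  then show ?thesis by (simp add: conj_part_def)
qed

text \<open>Trades equality of lists for equality of functions, zero beyond the last part included,
  which is the form that the reflection of beads into gaps needs. The lengths agree because the
  first column counts all rows.\<close>

lemma self_conjugate_iff:
  "l \<in> self_conjugate \<longleftrightarrow> is_partition l \<and> (\<forall>j\<ge>1. conj_part l j = part l j)"
proof
  assume "l \<in> self_conjugate"
  then have l: "is_partition l" and c: "conjugate l = l" by (auto simp: self_conjugate_def)
  have len: "part l 1 = length l"
    using arg_cong[OF c, of length] by (simp add: conjugate_def del: One_nat_def)
  have "conj_part l j = part l j" if j: "1 \<le> j" for j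
  proof (cases "j \<le> length l")
    case True
    have "l ! (j - 1) = conjugate l ! (j - 1)" by (simp add: c)
    also have "\<dots> = conj_part l j" using True j len by (simp add: conjugate_def del: upt_Suc)
    finally show ?thesis using True j by (simp add: part_def)
  next
    case False
    then have "\<not> 1 \<le> conj_part l j"
      using le_part_iff_le_conj_part[OF l, of 1 j] j len by simp
    with False show ?thesis by (simp add: part_def)
  qed
  with l show "is_partition l \<and> (\<forall>j\<ge>1. conj_part l j = part l j)" by blast
next
  assume r: "is_partition l \<and> (\<forall>j\<ge>1. conj_part l j = part l j)"
  then have len: "part l 1 = length l" using conj_part_1 by (metis le_refl)
  have "conjugate l = l"
  proof (rule nth_equalityI)
    show "length (conjugate l) = length l" using len by (simp add: conjugate_def del: upt_Suc)
    fix k assume "k < length (conjugate l)"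
    then show "conjugate l ! k = l ! k"
      using r len by (auto simp: conjugate_def part_def simp del: upt_Suc)
  qed
  with r show "l \<in> self_conjugate" by (simp add: self_conjugate_def)
qed

lemma part_1_self_conjugate: "l \<in> self_conjugate \<Longrightarrow> part l 1 = length l"
  by (metis conj_part_1 le_refl self_conjugate_iff)

definition bead :: "nat \<Rightarrow> nat list \<Rightarrow> nat \<Rightarrow> nat" where
  "bead n l i = part l i + n - i"

text \<open>The boundary path of the diagram, started at the bottom of row n and with steps numbered
  from 0, has its vertical steps at the numbers \<open>bead n l i\<close> and its horizontal steps
  at the numbers \<open>gap n l j\<close>, provided that n is at least the number of parts.\<close>

definition gap :: "nat \<Rightarrow> nat list \<Rightarrow> nat \<Rightarrow> nat" where
  "gap n l j = n + j - 1 - conj_part l j"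

definition beta_set :: "nat \<Rightarrow> nat list \<Rightarrow> nat set" where
  "beta_set n l = bead n l ` {1..n}"

lemma bead_strict_antimono:
  assumes "is_partition l" "1 \<le> i" "i < k" "k \<le> n"
  shows "bead n l k < bead n l i"
  using part_antimono[OF assms(1,2), of k] assms by (simp add: bead_def)

lemma inj_on_bead: "is_partition l \<Longrightarrow> inj_on (bead n l) {1..n}"
  by (rule linorder_inj_onI) (auto dest: bead_strict_antimono)

lemma gap_strict_mono:
  assumes "length l \<le> n" "1 \<le> j" "j < k"
  shows "gap n l j < gap n l k"
  using conj_part_antimono[of j k l] conj_part_le_length[of l j] assms by (simp add: gap_def)

lemma inj_on_gap: "length l \<le> n \<Longrightarrow> inj_on (gap n l) {1..m}"
  by (rule linorder_inj_onI) (auto dest: gap_strict_mono[of l n])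

text \<open>Bead minus gap is (part - j) + (conj_part - i) + 1. On a box both brackets are
  nonnegative and this is the hook length; off the diagram both are negative and the value is at
  most -1. So it is never 0.\<close>

lemma gap_less_bead_iff:
  assumes l: "is_partition l" and n: "length l \<le> n" and i: "1 \<le> i" "i \<le> n" and j: "1 \<le> j"
  shows "gap n l j < bead n l i \<longleftrightarrow> j \<le> part l i"
    and "gap n l j \<noteq> bead n l i"
  using le_part_iff_le_conj_part[OF l i(1) j] conj_part_le_length[of l j] assms
  by (auto simp: gap_def bead_def not_le)

text \<open>A count: n beads and n gaps, all distinct and below 2 n, leave no number over.\<close>

lemma gap_image:
  assumes l: "is_partition l" and n: "length l \<le> n" and m: "part l 1 \<le> n"
  shows "gap n l ` {1..n} = {..<2 * n} - beta_set n l"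
proof -
  have p: "part l i \<le> n" if "1 \<le> i" for i
    using part_antimono[OF l _ that] m by simp
  have b: "beta_set n l \<subseteq> {..<2 * n}"
  proof
    fix x assume "x \<in> beta_set n l"
    then obtain i where "1 \<le> i" "i \<le> n" "x = bead n l i" by (auto simp: beta_set_def)
    with p[of i] show "x \<in> {..<2 * n}" by (simp add: bead_def)
  qed
  have g: "gap n l ` {1..n} \<subseteq> {..<2 * n}"
    by (auto simp: gap_def)
  have d: "gap n l ` {1..n} \<inter> beta_set n l = {}"
    using gap_less_bead_iff(2)[OF l n] by (auto simp: beta_set_def)
  have "card (gap n l ` {1..n} \<union> beta_set n l) = card {..<2 * n}"
    using d inj_on_bead[OF l] inj_on_gap[OF n]
    by (subst card_Un_disjoint) (auto simp: beta_set_def card_image)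
  then have "gap n l ` {1..n} \<union> beta_set n l = {..<2 * n}"
    by (intro card_subset_eq) (use b g in auto)
  with d show ?thesis by blast
qed

section \<open>Hook lengths, size and BG-rank read off the beta-set\<close>

lemma finite_ferrers: "finite (ferrers l)"
  by (rule finite_subset[of _ "Sigma {1..length l} (\<lambda>i. {1..part l i})"]) (auto simp: ferrers_def)

lemma ferrers_eq:
  assumes "is_partition l" "length l \<le> n"
  shows "ferrers l = Sigma {1..n} (\<lambda>i. {1..part l i})"
  using assms part_pos_iff[OF assms(1)] by (fastforce simp: ferrers_def)

text \<open>A box is a bead together with a smaller gap, and its hook length is their difference.
  The bound on the first part puts all relevant gaps into the first n columns, where
  \<open>gap_image\<close> applies.\<close>

lemma size_hooks_div:
  assumes l: "is_partition l" and n: "length l \<le> n" and m: "part l 1 \<le> n"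
  shows "size (hooks_div t l) =
    card {(x, y). x \<in> beta_set n l \<and> y < x \<and> y \<notin> beta_set n l \<and> t dvd x - y}"
proof -
  have p: "part l i \<le> n" if "1 \<le> i" for i
    using part_antimono[OF l _ that] m by simp
  have hk: "hook l (i, j) = bead n l i - gap n l j" if "(i, j) \<in> ferrers l" for i j
  proof -
    from that have ij: "1 \<le> i" "i \<le> n" "1 \<le> j" "j \<le> part l i"
      using ferrers_eq[OF l n] by auto
    with le_part_iff_le_conj_part[OF l ij(1,3)] have "i \<le> conj_part l j" by simp
    with ij conj_part_le_length[of l j] n show ?thesis by (simp add: hook_def bead_def gap_def)
  qed
  have "size (hooks_div t l) = card {b \<in> ferrers l. t dvd hook l b}"
    by (simp add: hooks_div_def filter_mset_image_mset finite_ferrers)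
  also have "\<dots> =
    card {(x, y). x \<in> beta_set n l \<and> y < x \<and> y \<notin> beta_set n l \<and> t dvd x - y}"
  proof (rule bij_betw_same_card)
    show "bij_betw (\<lambda>(i, j). (bead n l i, gap n l j)) {b \<in> ferrers l. t dvd hook l b}
      {(x, y). x \<in> beta_set n l \<and> y < x \<and> y \<notin> beta_set n l \<and> t dvd x - y}" (is "bij_betw ?f ?A ?B")
      unfolding bij_betw_def
    proof
      have "j \<le> n" if "j \<le> part l i" "1 \<le> i" for i j
        using that p[of i] by simp
      then have "?A \<subseteq> {1..n} \<times> {1..n}" using ferrers_eq[OF l n] by auto
      moreover have "inj_on ?f ({1..n} \<times> {1..n})"
      proof (rule inj_onI, clarify)
        fix i j i' j'
        assume "i \<in> {1..n}" "j \<in> {1..n}" "i' \<in> {1..n}" "j' \<in> {1..n}"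
          and "bead n l i = bead n l i'" "gap n l j = gap n l j'"
        then show "i = i' \<and> j = j'"
          using inj_onD[OF inj_on_bead[OF l]] inj_onD[OF inj_on_gap[OF n]] by blast
      qed
      ultimately show "inj_on ?f ?A" by (rule inj_on_subset[rotated])
      show "?f ` ?A = ?B"
      proof
        show "?f ` ?A \<subseteq> ?B"
        proof clarsimp
          fix i j assume f: "(i, j) \<in> ferrers l" and d: "t dvd hook l (i, j)"
          then have ij: "1 \<le> i" "i \<le> n" "1 \<le> j" "j \<le> part l i"
            using ferrers_eq[OF l n] by auto
          with p have "j \<le> n" using le_trans by blast
          with ij gap_image[OF l n m] have "gap n l j \<notin> beta_set n l" by (metis DiffD2 atLeastAtMost_iff imageI)
          with ij d hk[OF f] gap_less_bead_iff(1)[OF l n ij(1,2,3)]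
          show "bead n l i \<in> beta_set n l \<and> gap n l j < bead n l i \<and> gap n l j \<notin> beta_set n l \<and>
            t dvd bead n l i - gap n l j"
            by (auto simp: beta_set_def)
        qed
        show "?B \<subseteq> ?f ` ?A"
        proof clarsimp
          fix x y assume x: "x \<in> beta_set n l" and y: "y < x" "y \<notin> beta_set n l" "t dvd x - y"
          from x obtain i where i: "1 \<le> i" "i \<le> n" "x = bead n l i" by (auto simp: beta_set_def)
          with p[OF i(1)] y have "y < 2 * n" by (simp add: bead_def)
          with y have "y \<in> gap n l ` {1..n}" using gap_image[OF l n m] by blast
          then obtain j where j: "1 \<le> j" "j \<le> n" "y = gap n l j" by auto
          with gap_less_bead_iff(1)[OF l n i(1,2) j(1)] i y have "(i, j) \<in> ferrers l"
            using ferrers_eq[OF l n] by auto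
          with hk[OF this] i j y show "(x, y) \<in> ?f ` ?A" by (auto intro!: rev_image_eqI[of "(i, j)"])
        qed
      qed
    qed
  qed
  finally show ?thesis .
qed

lemma sum_beta_set:
  assumes l: "is_partition l"
  shows "sum f (beta_set n l) = (\<Sum>i=1..n. f (bead n l i))"
  using inj_on_bead[OF l] by (simp add: beta_set_def sum.reindex)

lemma sum_list_eq_beta_set:
  assumes l: "is_partition l" and n: "length l \<le> n"
  shows "\<Sum> (beta_set n l) = sum_list l + \<Sum> {..<n}"
proof -
  have "\<Sum> (beta_set n l) = (\<Sum>i=1..n. part l i + (n - i))"
    unfolding sum_beta_set[OF l] by (rule sum.cong) (auto simp: bead_def)
  also have "\<dots> = (\<Sum>i=1..n. part l i) + (\<Sum>i=1..n. n - i)"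
    by (rule sum.distrib)
  also have "(\<Sum>i=1..n. n - i) = \<Sum> {..<n}"
    by (rule sum.reindex_bij_witness[of _ "\<lambda>i. n - i" "\<lambda>i. n - i"]) auto
  also have "(\<Sum>i=1..n. part l i) = (\<Sum>i=1..length l. part l i)"
    using n by (intro sum.mono_neutral_right) (auto simp: part_def)
  also have "\<dots> = (\<Sum>i=0..<length l. l ! i)"
    by (rule sum.reindex_bij_witness[of _ "\<lambda>i. i + 1" "\<lambda>i. i - 1"]) (auto simp: part_def)
  also have "\<dots> = sum_list l" by (simp add: sum_list_sum_nth)
  finally show ?thesis .
qed

lemma sum_neg_one_powers: "2 * (\<Sum>j=1..m. (-1) ^ (i + j)) = (-1) ^ (i + m) - (-1::int) ^ i"
  by (induction m) (auto simp: algebra_simps)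

text \<open>Twice a row sum telescopes to the difference of the signs at the two ends of the row.
  For even n the signs at the left ends cancel, and bead i has the parity of
  \<open>i + part l i\<close>.\<close>

lemma BG_rank_beta_set:
  assumes l: "is_partition l" and n: "length l \<le> n" "even n"
  shows "2 * BG_rank l = (\<Sum>x\<in>beta_set n l. (-1) ^ x)"
proof -
  have "2 * BG_rank l = (\<Sum>i=1..n. 2 * (\<Sum>j=1..part l i. (-1) ^ (i + j)))"
    by (simp add: BG_rank_def ferrers_eq[OF l n(1)] sum.Sigma flip: sum_distrib_left)
  also have "\<dots> = (\<Sum>i=1..n. (-1) ^ (i + part l i)) - (\<Sum>i=1..n. (-1) ^ i)"
    unfolding sum_neg_one_powers by (rule sum_subtractf)
  finally have 1: "2 * BG_rank l = (\<Sum>i=1..n. (-1) ^ (i + part l i)) - (\<Sum>i=1..n. (-1) ^ i)" .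
  have 2: "(\<Sum>i=1..n. (-1) ^ i) = (0::int)"
    using sum_neg_one_powers[where m = n and i = 0] n(2) by auto
  have 3: "(\<Sum>i=1..n. (-1::int) ^ (i + part l i)) = (\<Sum>i=1..n. (-1) ^ bead n l i)"
  proof (rule sum.cong[OF refl])
    fix i assume "i \<in> {1..n}"
    then have "even (i + part l i) \<longleftrightarrow> even (bead n l i)" using n(2) by (auto simp: bead_def)
    then show "(-1::int) ^ (i + part l i) = (-1) ^ bead n l i"
      by (cases "even (bead n l i)") simp_all
  qed
  show ?thesis unfolding sum_beta_set[OF l] 1 2 3 by simp
qed

subsection \<open>Symmetric beta-sets and self-conjugate partitions\<close>

lemma decreasing_image_above:
  fixes f :: "nat \<Rightarrow> nat"
  assumes f: "\<And>i k. 1 \<le> i \<Longrightarrow> i < k \<Longrightarrow> k \<le> n \<Longrightarrow> f k < f i" and i: "1 \<le> i" "i \<le> n"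
  shows "card {x \<in> f ` {1..n}. f i < x} = i - 1"
proof -
  have "{x \<in> f ` {1..n}. f i < x} = f ` {1..<i}"
  proof (intro equalityI subsetI)
    fix x assume "x \<in> {x \<in> f ` {1..n}. f i < x}"
    then obtain k where k: "1 \<le> k" "k \<le> n" "x = f k" "f i < f k" by auto
    have "k < i"
      using f[of i k] i k by (metis less_asym linorder_neqE_nat less_irrefl)
    with k show "x \<in> f ` {1..<i}" by auto
  next
    fix x assume "x \<in> f ` {1..<i}"
    with f[of _ i] i show "x \<in> {x \<in> f ` {1..n}. f i < x}" by auto
  qed
  moreover have "inj_on f {1..<i}"
  proof (rule linorder_inj_onI)
    fix a b assume "a < b" "a \<in> {1..<i}" "b \<in> {1..<i}"
    with f[of a b] i show "f a \<noteq> f b" by auto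
  qed auto
  ultimately show ?thesis by (simp add: card_image)
qed

text \<open>By \<open>decreasing_image_above\<close> the index of a value is one plus the number of
  larger elements of the image, so the image alone determines it.\<close>

lemma decreasing_enumeration_unique:
  fixes f g :: "nat \<Rightarrow> nat"
  assumes f: "\<And>i k. 1 \<le> i \<Longrightarrow> i < k \<Longrightarrow> k \<le> n \<Longrightarrow> f k < f i"
    and g: "\<And>i k. 1 \<le> i \<Longrightarrow> i < k \<Longrightarrow> k \<le> n \<Longrightarrow> g k < g i"
    and eq: "f ` {1..n} = g ` {1..n}" and i: "1 \<le> i" "i \<le> n"
  shows "f i = g i"
proof -
  have "f i \<in> g ` {1..n}" unfolding eq[symmetric] using i by auto
  then obtain k where k: "1 \<le> k" "k \<le> n" "f i = g k" by auto
  have "i - 1 = k - 1"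
    using decreasing_image_above[of n f i] decreasing_image_above[of n g k] f g eq i k by simp
  with i k have "i = k" by simp
  with k show ?thesis by simp
qed

lemma partition_eqI:
  assumes l: "is_partition l" and l': "is_partition l'"
    and eq: "\<And>i. 1 \<le> i \<Longrightarrow> part l i = part l' i"
  shows "l = l'"
proof -
  have "i \<le> length l \<longleftrightarrow> i \<le> length l'" if "1 \<le> i" for i
    using part_pos_iff[OF l that] part_pos_iff[OF l' that] eq[OF that] by simp
  from this[of "length l"] this[of "length l'"] have len: "length l = length l'"
    by linarith
  show ?thesis
  proof (rule nth_equalityI[OF len])
    fix i assume "i < length l"
    with eq[of "i + 1"] len show "l ! i = l' ! i" by (simp add: part_def)
  qed
qed

lemma ex_partition_of_parts:
  fixes p :: "nat \<Rightarrow> nat"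
  assumes "\<And>i k. 1 \<le> i \<Longrightarrow> i \<le> k \<Longrightarrow> k \<le> n \<Longrightarrow> p k \<le> p i"
  shows "\<exists>l. is_partition l \<and> length l \<le> n \<and> (\<forall>i. 1 \<le> i \<and> i \<le> n \<longrightarrow> part l i = p i)"
  using assms
proof (induction n)
  case 0
  show ?case by (intro exI[of _ "[]"]) (auto simp: is_partition_def)
next
  case (Suc n)
  show ?case
  proof (cases "p (Suc n) = 0")
    case True
    from Suc obtain l where "is_partition l" "length l \<le> n" "\<forall>i. 1 \<le> i \<and> i \<le> n \<longrightarrow> part l i = p i"
      by force
    moreover from this have "part l (Suc n) = 0" by (simp add: part_def)
    ultimately show ?thesis using True by (intro exI[of _ l]) (auto simp: le_Suc_eq)
  next
    case False
    then have "0 < p i" if "1 \<le> i" "i \<le> Suc n" for i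
      using Suc.prems[of i "Suc n"] that by auto
    with Suc.prems show ?thesis
      by (intro exI[of _ "map p [1..<Suc (Suc n)]"])
        (auto simp: is_partition_def sorted_wrt_iff_nth_less part_def simp del: upt_Suc)
  qed
qed

lemma sorted_list_of_set_nth_gap:
  fixes B :: "nat set"
  assumes "i \<le> k" "k < card B"
  shows "sorted_list_of_set B ! i + (k - i) \<le> sorted_list_of_set B ! k"
  using assms
proof (induction k rule: dec_induct)
  case base
  show ?case by simp
next
  case (step k)
  have "sorted_list_of_set B ! k < sorted_list_of_set B ! Suc k"
    using step.prems strict_sorted_list_of_set[of B]
    by (intro sorted_wrt_nth_less[of "(<)"]) auto
  with step show ?case by simp
qed

text \<open>Transposing a diagram reverses its boundary path and exchanges horizontal with vertical
  steps; these are the bead sets of the paths fixed by that operation.\<close>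

definition sym_sets :: "nat \<Rightarrow> nat set set" where
  "sym_sets n = {B. B \<subseteq> {..<2 * n} \<and> (\<forall>x<2 * n. 2 * n - 1 - x \<in> B \<longleftrightarrow> x \<notin> B)}"

lemma mirror_sym_sets:
  assumes "B \<in> sym_sets n"
  shows "(\<lambda>x. 2 * n - 1 - x) ` ({..<2 * n} - B) = B"
proof (intro equalityI subsetI)
  fix x assume x: "x \<in> B"
  with assms have "x < 2 * n" by (auto simp: sym_sets_def)
  with assms x have "2 * n - 1 - x \<in> {..<2 * n} - B" "x = 2 * n - 1 - (2 * n - 1 - x)"
    by (auto simp: sym_sets_def)
  then show "x \<in> (\<lambda>x. 2 * n - 1 - x) ` ({..<2 * n} - B)" by blast
qed (use assms in \<open>auto simp: sym_sets_def\<close>)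

lemma finite_sym_set: "B \<in> sym_sets n \<Longrightarrow> finite B"
  using finite_subset by (auto simp: sym_sets_def)

lemma card_sym_sets:
  assumes B: "B \<in> sym_sets n"
  shows "card B = n"
proof -
  have "inj_on (\<lambda>x. 2 * n - 1 - x) ({..<2 * n} - B)" by (auto simp: inj_on_def)
  then have "card B = card ({..<2 * n} - B)"
    using mirror_sym_sets[OF B] by (metis card_image)
  also have "\<dots> = 2 * n - card B"
    using B by (subst card_Diff_subset) (auto simp: finite_sym_set sym_sets_def)
  finally have "card B = 2 * n - card B" .
  moreover have "card B \<le> 2 * n"
    using card_mono[of "{..<2 * n}" B] B by (auto simp: sym_sets_def)
  ultimately show ?thesis by linarith
qed

lemma beta_set_in_sym_sets:
  assumes l: "l \<in> self_conjugate" and n: "length l \<le> n"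
  shows "beta_set n l \<in> sym_sets n"
proof -
  have p: "is_partition l" and c: "\<And>j. 1 \<le> j \<Longrightarrow> conj_part l j = part l j"
    using l by (auto simp: self_conjugate_iff)
  have 1: "part l 1 \<le> n" using part_1_self_conjugate[OF l] n by simp
  define m where "m x = 2 * n - 1 - x" for x
  have bd: "bead n l j < 2 * n" if "1 \<le> j" "j \<le> n" for j
    using part_antimono[OF p _ that(1)] 1 that by (simp add: bead_def)
  then have sub: "beta_set n l \<subseteq> {..<2 * n}" by (auto simp: beta_set_def)
  have "gap n l j = m (bead n l j)" if "1 \<le> j" "j \<le> n" for j
    using bd[OF that] c[of j] that by (auto simp: gap_def bead_def m_def)
  then have "gap n l ` {1..n} = m ` beta_set n l"
    unfolding beta_set_def image_image by (intro image_cong) auto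
  with gap_image[OF p n 1] have eq: "m ` beta_set n l = {..<2 * n} - beta_set n l" by simp
  have "m x \<in> beta_set n l \<longleftrightarrow> x \<notin> beta_set n l" if x: "x < 2 * n" for x
  proof
    assume "m x \<in> beta_set n l"
    then have "m (m x) \<in> {..<2 * n} - beta_set n l" using eq by blast
    with x show "x \<notin> beta_set n l" by (simp add: m_def)
  next
    assume "x \<notin> beta_set n l"
    with x eq have "x \<in> m ` beta_set n l" by blast
    with sub show "m x \<in> beta_set n l" by (auto simp: m_def)
  qed
  with sub show ?thesis by (simp add: sym_sets_def m_def)
qed

lemma inj_on_beta_set: "inj_on (beta_set n) {l \<in> self_conjugate. length l \<le> n}"
proof (rule inj_onI, clarsimp)
  fix l l' assume "l \<in> self_conjugate" "length l \<le> n" "l' \<in> self_conjugate" "length l' \<le> n"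
    and eq: "beta_set n l = beta_set n l'"
  then have l: "is_partition l" "length l \<le> n" and l': "is_partition l'" "length l' \<le> n"
    by (auto simp: self_conjugate_def)
  have "part l i = part l' i" if i: "1 \<le> i" for i
  proof (cases "i \<le> n")
    case True
    have "bead n l i = bead n l' i"
      using bead_strict_antimono[OF l(1)] bead_strict_antimono[OF l'(1)] eq i True
      by (intro decreasing_enumeration_unique[of n]) (auto simp: beta_set_def)
    with True show ?thesis by (simp add: bead_def)
  next
    case False
    with l l' show ?thesis by (simp add: part_def)
  qed
  with l l' show "l = l'" by (intro partition_eqI)
qed

text \<open>The parts are forced: the i-th largest element of \<open>B\<close> minus the number n -
  i of smaller elements. Self-conjugacy follows because the beads and the mirrored gaps are two
  decreasing enumerations of the same set \<open>B\<close>.\<close>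

lemma sym_sets_subset_beta_set:
  assumes B: "B \<in> sym_sets n"
  shows "\<exists>l\<in>self_conjugate. length l \<le> n \<and> beta_set n l = B"
proof -
  define xs where "xs = sorted_list_of_set B"
  have len: "length xs = n" by (simp add: xs_def card_sym_sets[OF B])
  have xs: "xs ! i + (k - i) \<le> xs ! k" if "i \<le> k" "k < n" for i k
    using sorted_list_of_set_nth_gap[OF that(1), of B] that card_sym_sets[OF B] by (simp add: xs_def)
  define p where "p i = xs ! (n - i) - (n - i)" for i
  have "p k \<le> p i" if "1 \<le> i" "i \<le> k" "k \<le> n" for i k
  proof -
    have "n - k \<le> n - i" "n - i < n" using that by auto
    from xs[OF this] show ?thesis unfolding p_def by linarith
  qed
  then obtain l where l: "is_partition l" and n: "length l \<le> n"
    and pl: "\<And>i. 1 \<le> i \<Longrightarrow> i \<le> n \<Longrightarrow> part l i = p i"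
    using ex_partition_of_parts[of n p] by blast
  have bd: "bead n l i = xs ! (n - i)" if "1 \<le> i" "i \<le> n" for i
    using xs[of 0 "n - i"] pl[OF that] that by (simp add: bead_def p_def)
  have beta: "beta_set n l = B"
  proof -
    have "beta_set n l = (\<lambda>i. xs ! (n - i)) ` {1..n}"
      unfolding beta_set_def using bd by (intro image_cong) auto
    also have "\<dots> = (\<lambda>i. xs ! i) ` (\<lambda>i. n - i) ` {1..n}"
      by (simp add: image_image)
    also have "(\<lambda>i. n - i) ` {1..n} = {0..<n}"
    proof (intro equalityI subsetI)
      fix i assume "i \<in> {0..<n}"
      then show "i \<in> (\<lambda>i. n - i) ` {1..n}" by (intro image_eqI[of _ _ "n - i"]) auto
    qed auto
    also have "(\<lambda>i. xs ! i) ` {0..<n} = set xs"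
      using len by (auto simp: set_conv_nth)
    also have "\<dots> = B" using finite_sym_set[OF B] by (simp add: xs_def)
    finally show ?thesis .
  qed
  have 1: "part l 1 \<le> n"
  proof (cases "n = 0")
    case False
    then have "bead n l 1 \<in> B" unfolding beta[symmetric] beta_set_def by auto
    with B have "bead n l 1 < 2 * n" by (auto simp: sym_sets_def)
    with False show ?thesis by (simp add: bead_def)
  qed (use n in \<open>simp add: part_def\<close>)
  have cl: "conj_part l j \<le> n" for j using conj_part_le_length[of l j] n by simp
  have conj: "conj_part l j = part l j" if j: "1 \<le> j" for j
  proof (cases "j \<le> n")
    case True
    have "bead n l j = 2 * n - 1 - gap n l j"
    proof (rule decreasing_enumeration_unique[of n "bead n l" "\<lambda>j. 2 * n - 1 - gap n l j"])
      show "bead n l k < bead n l i" if "1 \<le> i" "i < k" "k \<le> n" for i k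
        using that by (rule bead_strict_antimono[OF l])
      show "2 * n - 1 - gap n l k < 2 * n - 1 - gap n l i" if "1 \<le> i" "i < k" "k \<le> n" for i k
        using gap_strict_mono[OF n that(1,2)] that cl[of k] by (simp add: gap_def)
      show "bead n l ` {1..n} = (\<lambda>j. 2 * n - 1 - gap n l j) ` {1..n}"
      proof -
        have "(\<lambda>j. 2 * n - 1 - gap n l j) ` {1..n} = (\<lambda>x. 2 * n - 1 - x) ` gap n l ` {1..n}"
          by (simp only: image_image)
        also have "\<dots> = beta_set n l"
          unfolding gap_image[OF l n 1] beta by (rule mirror_sym_sets[OF B])
        finally show ?thesis by (simp only: beta_set_def)
      qed
    qed (use True j in auto)
    with cl[of j] True j show ?thesis by (simp add: bead_def gap_def)
  next
    case False
    then have "part l j = 0" using n by (simp add: part_def)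
    moreover have "\<not> 1 \<le> conj_part l j"
      using le_part_iff_le_conj_part[OF l, of 1 j] j 1 False by simp
    ultimately show ?thesis by simp
  qed
  with l n beta show ?thesis by (auto simp: self_conjugate_iff)
qed

lemma bij_betw_beta_set:
  "bij_betw (beta_set n) {l \<in> self_conjugate. length l \<le> n} (sym_sets n)"
  unfolding bij_betw_def using inj_on_beta_set beta_set_in_sym_sets sym_sets_subset_beta_set
  by blast

subsection \<open>Inversions and runners\<close>

text \<open>For finite \<open>S\<close>, the number of boxes of the partition that has
  \<open>S\<close> as beta-set.\<close>

definition inversions :: "nat set \<Rightarrow> nat" where
  "inversions S = card {(x, y). x \<in> S \<and> y < x \<and> y \<notin> S}"

lemma finite_inversions:
  fixes S :: "nat set"
  assumes "finite S"
  shows "finite {(x, y). x \<in> S \<and> y < x \<and> y \<notin> S}"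
proof (rule finite_subset)
  show "{(x, y). x \<in> S \<and> y < x \<and> y \<notin> S} \<subseteq> Sigma S (\<lambda>x. {..<x})" by auto
qed (use assms in auto)

lemma inversions_insert_max:
  fixes A :: "nat set"
  assumes A: "finite A" and b: "\<And>a. a \<in> A \<Longrightarrow> a < b"
  shows "inversions (insert b A) = inversions A + (b - card A)"
proof -
  have "{(x, y). x \<in> insert b A \<and> y < x \<and> y \<notin> insert b A} =
    {(x, y). x \<in> A \<and> y < x \<and> y \<notin> A} \<union> {b} \<times> ({..<b} - A)"
    using b by fastforce
  moreover have "card ({b} \<times> ({..<b} - A)) = b - card A"
    using A b by (subst card_cartesian_product) (auto simp: card_Diff_subset subset_eq)
  moreover have "b \<notin> A" using b by blast
  ultimately show ?thesis
    unfolding inversions_def using finite_inversions[OF A]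
    by (simp, subst card_Un_disjoint) auto
qed

text \<open>Induction on the maximum: a new largest element b has \<open>b - card A\<close> gaps
  below it, and its b is shared out between these and the new summand \<open>card A\<close>.\<close>

lemma sum_eq_inversions:
  fixes S :: "nat set"
  assumes "finite S"
  shows "\<Sum> S = inversions S + \<Sum> {..<card S}"
  using assms
proof (induction S rule: finite_linorder_max_induct)
  case empty
  show ?case by (simp add: inversions_def)
next
  case (insert b A)
  have "A \<subseteq> {..<b}" using insert by auto
  then have "card A \<le> b" using card_mono[of "{..<b}" A] by simp
  moreover have "b \<notin> A" using insert by auto
  ultimately show ?case
    using insert inversions_insert_max[of A b] by (simp add: lessThan_Suc)
qed

text \<open>Reflection turns the order of a pair around and complementation exchanges bead and gap,
  so the two together preserve inversions. In terms of diagrams, conjugation preserves the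
  size.\<close>

lemma inversions_mirror:
  assumes S: "S \<subseteq> {..<m}"
  shows "inversions {s. s < m \<and> m - 1 - s \<notin> S} = inversions S"
  unfolding inversions_def
proof (rule bij_betw_same_card)
  let ?h = "\<lambda>(x, y). (m - 1 - y, m - 1 - x)"
  let ?T = "{s. s < m \<and> m - 1 - s \<notin> S}"
  let ?A = "{(x, y). x \<in> ?T \<and> y < x \<and> y \<notin> ?T}" and ?B = "{(x, y). x \<in> S \<and> y < x \<and> y \<notin> S}"
  have S': "x < m" if "x \<in> S" for x using S that by auto
  have S'': "m - Suc (m - Suc x) = x" if "x \<in> S" for x using S'[OF that] by simp
  show "bij_betw ?h ?A ?B"
    by (rule bij_betw_byWitness[where f' = ?h]) (auto simp: S'' dest: S')
qed

definition runner :: "nat \<Rightarrow> nat \<Rightarrow> nat set \<Rightarrow> nat set" where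
  "runner t r B = {s. t * s + r \<in> B}"

lemma finite_runner: "finite B \<Longrightarrow> 0 < t \<Longrightarrow> finite (runner t r B)"
  unfolding runner_def by (rule finite_vimageI[unfolded vimage_def]) (auto simp: inj_def)

lemma sum_runner:
  fixes f :: "nat \<Rightarrow> 'a::comm_monoid_add"
  assumes "finite B" "0 < t"
  shows "sum f B = (\<Sum>r<t. \<Sum>s\<in>runner t r B. f (t * s + r))"
proof -
  have "(\<Sum>r<t. \<Sum>s\<in>runner t r B. f (t * s + r)) =
    (\<Sum>(r, s)\<in>Sigma {..<t} (\<lambda>r. runner t r B). f (t * s + r))"
    by (rule sum.Sigma) (auto intro: finite_runner assms)
  also have "\<dots> = sum f B"
    by (rule sum.reindex_bij_witness[of _ "\<lambda>x. (x mod t, x div t)" "\<lambda>(r, s). t * s + r"])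
      (use assms in \<open>auto simp: runner_def\<close>)
  finally show ?thesis ..
qed

lemma card_inversions_mod:
  assumes "finite B" "0 < t"
  shows "card {(x, y). x \<in> B \<and> y < x \<and> y \<notin> B \<and> t dvd x - y} = (\<Sum>r<t. inversions (runner t r B))"
proof -
  let ?I = "\<lambda>r. {(x, y). x \<in> runner t r B \<and> y < x \<and> y \<notin> runner t r B}"
  have "(\<Sum>r<t. inversions (runner t r B)) = card (Sigma {..<t} ?I)"
    using assms by (simp add: inversions_def finite_inversions finite_runner)
  also have "\<dots> = card {(x, y). x \<in> B \<and> y < x \<and> y \<notin> B \<and> t dvd x - y}"
  proof (rule bij_betw_same_card)
    let ?f = "\<lambda>(r, x, y). (t * x + r, t * y + r)"
    let ?g = "\<lambda>(x, y). (x mod t, x div t, y div t)"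
    let ?B = "{(x, y). x \<in> B \<and> y < x \<and> y \<notin> B \<and> t dvd x - y}"
    have m: "x mod t = y mod t" if "(x, y) \<in> ?B" for x y
      using that mod_eq_dvd_iff_nat[of y x t] by auto
    show "bij_betw ?f (Sigma {..<t} ?I) ?B"
    proof (rule bij_betw_byWitness[where f' = ?g])
      show "\<forall>a\<in>Sigma {..<t} ?I. ?g (?f a) = a" using assms by auto
      show "\<forall>a\<in>?B. ?f (?g a) = a"
      proof
        fix a assume a: "a \<in> ?B"
        obtain x y where xy: "a = (x, y)" by fastforce
        have mm: "x mod t = y mod t" using m a unfolding xy by blast
        have "t * (y div t) + x mod t = y" unfolding mm by simp
        then show "?f (?g a) = a" by (simp add: xy)
      qed
      show "?f ` Sigma {..<t} ?I \<subseteq> ?B"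
        by (auto simp: runner_def assms simp flip: diff_mult_distrib2)
      show "?g ` ?B \<subseteq> Sigma {..<t} ?I"
      proof
        fix z assume "z \<in> ?g ` ?B"
        then obtain x y where z: "z = (x mod t, x div t, y div t)"
          and a: "x \<in> B" "y < x" "y \<notin> B" "t dvd x - y" by auto
        then have m: "x mod t = y mod t" using m[of x y] by simp
        have "t * (x div t) + x mod t = x" by simp
        moreover have "t * (y div t) + x mod t = y" unfolding m by simp
        moreover have "y div t < x div t"
        proof (rule ccontr)
          assume "\<not> y div t < x div t"
          then have "t * (x div t) \<le> t * (y div t)" by simp
          with calculation a(2) show False by linarith
        qed
        ultimately show "z \<in> Sigma {..<t} ?I"
          using a assms unfolding z by (simp add: runner_def)
      qed
    qed
  qed
  finally show ?thesis ..
qed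

lemma sum_pair_up:
  fixes f :: "nat \<Rightarrow> 'a::comm_monoid_add"
  shows "(\<Sum>r<2 * h. f r) = (\<Sum>r<h. f r + f (2 * h - 1 - r))"
proof -
  have "(\<Sum>r<2 * h. f r) = (\<Sum>r\<in>{..<h} \<union> {h..<2 * h}. f r)"
    by (rule sum.cong) auto
  also have "\<dots> = (\<Sum>r<h. f r) + (\<Sum>r=h..<2 * h. f r)"
    by (rule sum.union_disjoint) auto
  also have "(\<Sum>r=h..<2 * h. f r) = (\<Sum>r<h. f (2 * h - 1 - r))"
    by (rule sum.reindex_bij_witness[of _ "\<lambda>r. 2 * h - 1 - r" "\<lambda>r. 2 * h - 1 - r"]) auto
  finally show ?thesis by (simp add: sum.distrib)
qed

text \<open>As 2 t N - 1 = t (2 N - 1) + (t - 1), the reflection acts on quotient and remainder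
  separately, without a carry.\<close>

lemma mirror_runner_index:
  fixes s N t r :: nat
  assumes "s < 2 * N" "r < t"
  shows "2 * (t * N) - 1 - (t * (2 * N - 1 - s) + r) = t * s + (t - 1 - r)"
    and "t * s + r < 2 * (t * N)"
proof -
  obtain k where "2 * N = s + 1 + k" using assms(1) less_iff_Suc_add[of s "2 * N"] by auto
  moreover have "2 * (t * N) = t * (2 * N)" by simp
  ultimately show "2 * (t * N) - 1 - (t * (2 * N - 1 - s) + r) = t * s + (t - 1 - r)"
    "t * s + r < 2 * (t * N)"
    using assms(2) by (auto simp: algebra_simps)
qed

lemma runner_subset:
  assumes B: "B \<in> sym_sets (t * N)"
  shows "runner t r B \<subseteq> {..<2 * N}"
proof
  fix s assume "s \<in> runner t r B"
  with B have "t * s + r < t * (2 * N)" by (auto simp: runner_def sym_sets_def)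
  then have "t * s < t * (2 * N)" by linarith
  then show "s \<in> {..<2 * N}" by simp
qed

lemma runner_mirror:
  assumes B: "B \<in> sym_sets (t * N)" and r: "r < t"
  shows "runner t (t - 1 - r) B = {s. s < 2 * N \<and> 2 * N - 1 - s \<notin> runner t r B}"
proof (rule set_eqI)
  fix s
  show "s \<in> runner t (t - 1 - r) B \<longleftrightarrow> s \<in> {s. s < 2 * N \<and> 2 * N - 1 - s \<notin> runner t r B}"
  proof (cases "s < 2 * N")
    case True
    have "t * (2 * N - 1 - s) + r < 2 * (t * N)"
      by (rule mirror_runner_index(2)) (use True r in auto)
    with B have "2 * (t * N) - 1 - (t * (2 * N - 1 - s) + r) \<in> B \<longleftrightarrow> t * (2 * N - 1 - s) + r \<notin> B"
      unfolding sym_sets_def by blast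
    with True show ?thesis unfolding mirror_runner_index(1)[OF True r] by (simp add: runner_def)
  next
    case False
    with runner_subset[OF B, of "t - 1 - r"] show ?thesis by auto
  qed
qed

text \<open>Exactly one of r and t - 1 - r lies below h. Hence the lower runners determine the upper
  ones by \<open>runner_mirror\<close>, and conversely any choice of lower runners extends, the
  symmetry condition being used up in defining the upper ones.\<close>

lemma bij_betw_runners:
  fixes h :: nat
  assumes h: "0 < h" and t: "t = 2 * h"
  shows "bij_betw (\<lambda>B. restrict (\<lambda>r. runner t r B) {..<h}) (sym_sets (t * N))
    (PiE {..<h} (\<lambda>_. Pow {..<2 * N}))"
  unfolding bij_betw_def
proof
  have mem: "x \<in> B \<longleftrightarrow> x div t \<in> runner t (x mod t) B" for x B
    by (simp add: runner_def)
  show "inj_on (\<lambda>B. restrict (\<lambda>r. runner t r B) {..<h}) (sym_sets (t * N))"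
  proof (rule inj_onI)
    fix B C assume B: "B \<in> sym_sets (t * N)" and C: "C \<in> sym_sets (t * N)"
      and eq: "restrict (\<lambda>r. runner t r B) {..<h} = restrict (\<lambda>r. runner t r C) {..<h}"
    have low: "runner t r B = runner t r C" if "r < h" for r
      using fun_cong[OF eq, of r] that by simp
    have "runner t r B = runner t r C" if r: "r < t" for r
    proof (cases "r < h")
      case False
      have r': "t - 1 - r < h" "t - 1 - r < t" "t - 1 - (t - 1 - r) = r" using False r t by auto
      show ?thesis
        using runner_mirror[OF B r'(2)] runner_mirror[OF C r'(2)] low[OF r'(1)] r'(3) by simp
    qed (rule low)
    then show "B = C" using mem h t by (intro set_eqI) (metis mod_less_divisor nat_0_less_mult_iff zero_less_numeral)
  qed
  show "(\<lambda>B. restrict (\<lambda>r. runner t r B) {..<h}) ` sym_sets (t * N) = PiE {..<h} (\<lambda>_. Pow {..<2 * N})"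
  proof (intro equalityI subsetI)
    fix g assume g: "g \<in> PiE {..<h} (\<lambda>_. Pow {..<2 * N})"
    define B where "B = {x. x < 2 * (t * N) \<and> (if x mod t < h then x div t \<in> g (x mod t)
      else 2 * N - 1 - x div t \<notin> g (t - 1 - x mod t))}"
    have run: "runner t r B = g r" if r: "r < h" for r
    proof -
      from g r have sub: "g r \<subseteq> {..<2 * N}" by auto
      have "s \<in> runner t r B \<longleftrightarrow> s \<in> g r" for s
      proof (cases "s < 2 * N")
        case True
        with mirror_runner_index(2)[OF True, of r t] r t show ?thesis by (simp add: runner_def B_def)
      next
        case False
        then have "t * (2 * N) \<le> t * s" by simp
        then have "\<not> t * s + r < 2 * (t * N)" by (simp add: not_less trans_le_add1 mult.left_commute)
        with False sub show ?thesis by (auto simp: runner_def B_def)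
      qed
      then show ?thesis by blast
    qed
    have "B \<in> sym_sets (t * N)"
      unfolding sym_sets_def
    proof (intro CollectI conjI allI impI)
      fix x assume x: "x < 2 * (t * N)"
      define s r where "s = x div t" and "r = x mod t"
      have t0: "0 < t" using h t by simp
      have xs: "x = t * s + r" and r: "r < t" using t0 by (auto simp: s_def r_def)
      from x have "t * s < 2 * (t * N)" using xs by linarith
      then have "t * s < t * (2 * N)" by (simp only: mult.left_commute)
      then have s: "s < 2 * N" by simp
      define s' r' where "s' = 2 * N - 1 - s" and "r' = t - 1 - r"
      have s': "s' < 2 * N" "s = 2 * N - 1 - s'" and r': "r' < t" "r = t - 1 - r'"
        using s r by (auto simp: s'_def r'_def)
      have mir: "2 * (t * N) - 1 - x = t * s' + r'"
        using mirror_runner_index(1)[OF s'(1) r] by (simp add: xs r'_def s'(2))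
      have mm: "t * s' + r' < 2 * (t * N)" by (rule mirror_runner_index(2)[OF s'(1) r'(1)])
      have e: "2 * N - Suc s = s'" "2 * N - Suc s' = s" "t - Suc r = r'" "t - Suc r' = r"
        using s r by (auto simp: s'_def r'_def)
      have "r < h \<longleftrightarrow> \<not> r' < h" using r t by (auto simp: r'_def)
      then show "2 * (t * N) - 1 - x \<in> B \<longleftrightarrow> x \<notin> B"
        unfolding mir B_def using x mm r'(1) e
        by (simp add: s_def[symmetric] r_def[symmetric])
    qed (auto simp: B_def)
    moreover have "restrict (\<lambda>r. runner t r B) {..<h} = g"
    proof (rule extensionalityI)
      show "g \<in> extensional {..<h}" using g by (simp add: PiE_def)
    qed (simp_all add: run)
    ultimately show "g \<in> (\<lambda>B. restrict (\<lambda>r. runner t r B) {..<h}) ` sym_sets (t * N)" by blast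
  next
    fix g assume "g \<in> (\<lambda>B. restrict (\<lambda>r. runner t r B) {..<h}) ` sym_sets (t * N)"
    then obtain B where B: "B \<in> sym_sets (t * N)" "g = restrict (\<lambda>r. runner t r B) {..<h}"
      by blast
    show "g \<in> PiE {..<h} (\<lambda>_. Pow {..<2 * N})"
      unfolding B(2) by (simp only: restrict_PiE_iff Pow_iff runner_subset[OF B(1)]) simp
  qed
qed

subsection \<open>Gaussian binomials modulo powers of q\<close>

text \<open>Congruence modulo q^K, the coefficients in x and b being compared exactly. By
  \<open>qcong_eqI\<close>, an identity of series may be checked at each precision K separately,
  with a truncation chosen for that K.\<close>

definition qcong :: "nat \<Rightarrow> coeffs fps \<Rightarrow> coeffs fps \<Rightarrow> bool" where
  "qcong K f g \<longleftrightarrow> (\<forall>k<K. fps_nth f k = fps_nth g k)"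

lemma qcong_refl [simp]: "qcong K f f"
  by (simp add: qcong_def)

lemma qcong_sym: "qcong K f g \<Longrightarrow> qcong K g f"
  by (simp add: qcong_def)

lemma qcong_trans [trans]: "qcong K f g \<Longrightarrow> qcong K g h \<Longrightarrow> qcong K f h"
  by (simp add: qcong_def)

lemma qcong_mono: "qcong K f g \<Longrightarrow> M \<le> K \<Longrightarrow> qcong M f g"
  by (auto simp: qcong_def)

lemma qcong_eqI: "(\<And>K. qcong K f g) \<Longrightarrow> f = g"
  by (rule fps_ext) (auto simp: qcong_def)

lemma qcong_diff: "qcong K f f' \<Longrightarrow> qcong K g g' \<Longrightarrow> qcong K (f - g) (f' - g')"
  by (simp add: qcong_def)

lemma qcong_mult:
  assumes "qcong K f f'" "qcong K g g'"
  shows "qcong K (f * g) (f' * g')"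
  using assms unfolding qcong_def fps_mult_nth by (auto intro!: sum.cong)

lemma qcong_sum: "(\<And>x. x \<in> A \<Longrightarrow> qcong K (f x) (g x)) \<Longrightarrow> qcong K (sum f A) (sum g A)"
  unfolding qcong_def fps_sum_nth by (auto intro: sum.cong)

lemma qcong_prod: "(\<And>x. x \<in> A \<Longrightarrow> qcong K (f x) (g x)) \<Longrightarrow> qcong K (prod f A) (prod g A)"
  by (induction A rule: infinite_finite_induct) (auto intro: qcong_mult)

lemma nth_q_power_mult: "fps_nth (q_var ^ m * f) k = (if k < m then 0 else fps_nth f (k - m))"
  by (simp add: q_var_def fps_X_power_mult_nth)

lemma qcong_q_power_mult_0: "K \<le> m \<Longrightarrow> qcong K (q_var ^ m * f) 0"
  by (simp add: qcong_def nth_q_power_mult)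

lemma qcong_q_power_mult:
  "qcong K f g \<Longrightarrow> qcong (m + K) (q_var ^ m * f) (q_var ^ m * g)"
  by (auto simp: qcong_def nth_q_power_mult)

lemma qcong_LIMSEQ:
  assumes "F \<longlonglongrightarrow> L" and "\<forall>\<^sub>F n in sequentially. qcong K (F n) G"
  shows "qcong K L G"
  unfolding qcong_def
proof (intro allI impI)
  fix k assume k: "k < K"
  from assms(1) have "\<forall>\<^sub>F n in sequentially. fps_nth (F n) k = fps_nth L k"
    unfolding tendsto_fps_iff by blast
  with assms(2) have "\<forall>\<^sub>F n in sequentially. fps_nth L k = fps_nth G k"
    by eventually_elim (use k in \<open>simp add: qcong_def\<close>)
  then show "fps_nth L k = fps_nth G k" by simp
qed

text \<open>The factors from index m on are 1 modulo q^K, so the partial products are stationary at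
  that precision.\<close>

lemma qcong_qpoch_inf:
  assumes a: "fps_nth a 0 = 0" and y: "fps_nth y 0 = 0"
    and small: "\<And>j. m \<le> j \<Longrightarrow> qcong K (a * y ^ j) 0"
  shows "qcong K (qpoch_inf a y) (\<Prod>j<m. 1 - a * y ^ j)"
proof (rule qcong_LIMSEQ[OF qpoch_inf_LIMSEQ(1)[OF a y]])
  have "qcong K (\<Prod>j<n. 1 - a * y ^ j) (\<Prod>j<m. 1 - a * y ^ j)" if "m \<le> n" for n
    using that
  proof (induction n rule: dec_induct)
    case (step n)
    have "qcong K ((\<Prod>j<n. 1 - a * y ^ j) * (1 - a * y ^ n)) ((\<Prod>j<m. 1 - a * y ^ j) * (1 - 0))"
      by (intro qcong_mult qcong_diff step.IH small step.hyps qcong_refl)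
    then show ?case by simp
  qed simp
  then have "qcong K (\<Prod>j\<le>n. 1 - a * y ^ j) (\<Prod>j<m. 1 - a * y ^ j)" if "m \<le> n" for n
    using that by (simp only: lessThan_Suc_atMost[symmetric])
  then show "\<forall>\<^sub>F n in sequentially. qcong K (\<Prod>j\<le>n. 1 - a * y ^ j) (\<Prod>j<m. 1 - a * y ^ j)"
    unfolding eventually_sequentially by blast
qed

text \<open>The Gaussian binomial as generating function of the partitions in a k by n - k box, the
  form in which runners with a fixed number of beads produce it.\<close>

definition gauss_binomial :: "nat \<Rightarrow> nat \<Rightarrow> 'a::comm_ring_1 \<Rightarrow> 'a" where
  "gauss_binomial n k y = (\<Sum>S | S \<subseteq> {..<n} \<and> card S = k. y ^ inversions S)"

lemma gauss_binomial_0: "gauss_binomial n 0 y = 1"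
proof -
  have "{S. S \<subseteq> {..<n} \<and> card S = 0} = {{}}"
    using finite_subset by fastforce
  then show ?thesis by (simp add: gauss_binomial_def inversions_def)
qed

lemma gauss_binomial_eq_0:
  assumes "n < k"
  shows "gauss_binomial n k y = 0"
proof -
  have "card S \<noteq> k" if "S \<subseteq> {..<n}" for S :: "nat set"
    using card_mono[OF _ that] assms by simp
  then have "{S. S \<subseteq> {..<n} \<and> card S = k} = {}" by blast
  then show ?thesis unfolding gauss_binomial_def by (simp only: sum.empty)
qed

text \<open>Split by whether n belongs to the set; as a new maximum above k elements, n creates n -
  k inversions. For k > n the truncated exponent is harmless, since no set is counted.\<close>

lemma gauss_binomial_Suc:
  "gauss_binomial (Suc n) (Suc k) y = gauss_binomial n (Suc k) y + y ^ (n - k) * gauss_binomial n k y"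
proof -
  let ?A = "\<lambda>(n::nat) k. {S. S \<subseteq> {..<n} \<and> card S = k}"
  have fin: "finite (?A n k)" for n k
    by (rule finite_subset[of _ "Pow {..<n}"]) auto
  have finS: "finite S" if "S \<subseteq> {..<n}" for S :: "nat set"
    using that finite_subset by blast
  have not: "n \<notin> S" if "S \<subseteq> {..<n}" for S :: "nat set"
    using that by auto
  have eq: "?A (Suc n) (Suc k) = ?A n (Suc k) \<union> insert n ` ?A n k"
  proof (intro equalityI subsetI)
    fix S assume S: "S \<in> ?A (Suc n) (Suc k)"
    show "S \<in> ?A n (Suc k) \<union> insert n ` ?A n k"
    proof (cases "n \<in> S")
      case True
      then have "S = insert n (S - {n})" by blast
      moreover have "S - {n} \<in> ?A n k" using S True by (auto simp: lessThan_Suc)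
      ultimately show ?thesis by blast
    next
      case False
      with S show ?thesis by (auto simp: lessThan_Suc)
    qed
  next
    fix S assume "S \<in> ?A n (Suc k) \<union> insert n ` ?A n k"
    then consider "S \<in> ?A n (Suc k)" | T where "T \<in> ?A n k" "S = insert n T" by blast
    then show "S \<in> ?A (Suc n) (Suc k)"
    proof cases
      case 2
      then show ?thesis using finS[of T] not[of T] by (auto simp: lessThan_Suc)
    qed (auto simp: lessThan_Suc)
  qed
  have inj: "inj_on (insert n) (?A n k)"
  proof (rule inj_onI)
    fix S T assume "S \<in> ?A n k" "T \<in> ?A n k" and eq: "insert n S = insert n T"
    then have "n \<notin> S" "n \<notin> T" using not by blast+
    with eq show "S = T" by (simp add: insert_ident)
  qed
  have "gauss_binomial (Suc n) (Suc k) y =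
      gauss_binomial n (Suc k) y + (\<Sum>S\<in>insert n ` ?A n k. y ^ inversions S)"
    unfolding gauss_binomial_def eq
    by (rule sum.union_disjoint) (use fin not in auto)
  also have "(\<Sum>S\<in>insert n ` ?A n k. y ^ inversions S) = (\<Sum>S\<in>?A n k. y ^ (n - k) * y ^ inversions S)"
    unfolding sum.reindex[OF inj] o_def
  proof (rule sum.cong[OF refl])
    fix S assume S: "S \<in> ?A n k"
    then have "a < n" if "a \<in> S" for a using that by auto
    with S show "y ^ inversions (insert n S) = y ^ (n - k) * y ^ inversions S"
      using inversions_insert_max[of S n] finS by (auto simp: power_add mult.commute)
  qed
  finally show ?thesis by (simp add: gauss_binomial_def sum_distrib_left)
qed

text \<open>The quotient formula, written without division so that it holds in every commutative
  ring. With n = i + m + 1 the induction step rests on (1 - y^(m+1)) + y^(m+1) (1 - y^(i+1)) = 1 -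
  y^(n+1).\<close>

lemma gauss_binomial_prod:
  fixes y :: "'a::comm_ring_1"
  assumes "k \<le> n"
  shows "gauss_binomial n k y * (\<Prod>j<k. 1 - y * y ^ j) * (\<Prod>j<n - k. 1 - y * y ^ j) =
    (\<Prod>j<n. 1 - y * y ^ j)"
  using assms
proof (induction n arbitrary: k)
  case 0
  then show ?case by (simp add: gauss_binomial_0)
next
  case (Suc n)
  define P where "P m = (\<Prod>j<m. 1 - y * y ^ j)" for m
  have P: "P (Suc m) = P m * (1 - y * y ^ m)" for m by (simp add: P_def)
  have IH: "gauss_binomial n k y * P k * P (n - k) = P n" if "k \<le> n" for k
    using Suc.IH[OF that] by (simp add: P_def)
  have "gauss_binomial (Suc n) k y * P k * P (Suc n - k) = P (Suc n)"
  proof (cases k)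
    case 0
    then show ?thesis by (simp add: gauss_binomial_0 P_def)
  next
    case (Suc i)
    show ?thesis
    proof (cases "i < n")
      case True
      define m where "m = n - Suc i"
      have m: "n - i = Suc m" "n = i + Suc m" using True by (auto simp: m_def)
      have 1: "gauss_binomial n (Suc i) y * P (Suc i) * P m = P n"
        using IH[of "Suc i"] True by (simp add: m_def)
      have 2: "gauss_binomial n i y * P i * P (Suc m) = P n"
        using IH[of i] True m by simp
      have "gauss_binomial (Suc n) k y * P k * P (Suc n - k) =
        (gauss_binomial n (Suc i) y * P (Suc i) * P m) * (1 - y * y ^ m) +
        y ^ Suc m * (1 - y * y ^ i) * (gauss_binomial n i y * P i * P (Suc m))"
        using Suc m(1) by (simp add: gauss_binomial_Suc P algebra_simps)
      also have "\<dots> = P n * (1 - y * y ^ n)"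
        unfolding 1 2 using m(2) by (simp add: algebra_simps power_add)
      finally show ?thesis by (simp add: P)
    next
      case False
      with Suc Suc.prems have i: "i = n" by simp
      have "gauss_binomial n n y * P n = P n" using IH[of n] by (simp add: P_def)
      then have "gauss_binomial n n y * P n * (1 - y * y ^ n) = P n * (1 - y * y ^ n)" by simp
      with Suc i show ?thesis
        by (simp add: gauss_binomial_Suc gauss_binomial_eq_0 P mult.assoc) (simp add: P_def)
    qed
  qed
  then show ?case by (simp add: P_def)
qed

text \<open>Modulo q^K all three products in \<open>gauss_binomial_prod\<close> become L = (y;
  y)_oo, so the binomial times L^2 is L; one L cancels because L has constant coefficient 1.\<close>

lemma qcong_gauss_binomial:
  assumes y: "fps_nth y 0 = 0" and k: "k \<le> n" and small: "qcong K (y * y ^ min k (n - k)) 0"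
  shows "qcong K (gauss_binomial n k y * qpoch_inf y y) 1"
proof -
  define L where "L = qpoch_inf y y"
  define P where "P m = (\<Prod>j<m. 1 - y * y ^ j)" for m
  have "fps_nth L 0 = 1" unfolding L_def by (rule qpoch_inf_LIMSEQ(2)[OF y y])
  then have L: "L * recip L = 1" by (rule mult_recip)
  have s: "qcong K (y * y ^ j) 0" if "min k (n - k) \<le> j" for j
  proof -
    define m where "m = min k (n - k)"
    have "y ^ j = y ^ m * y ^ (j - m)"
      unfolding power_add[symmetric] m_def using that by simp
    then have eq: "y * y ^ j = (y * y ^ m) * y ^ (j - m)" by (simp only: mult.assoc)
    have "qcong K ((y * y ^ m) * y ^ (j - m)) (0 * y ^ (j - m))"
      unfolding m_def by (intro qcong_mult small qcong_refl)
    then show ?thesis by (simp only: eq mult_zero_left)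
  qed
  have LP: "qcong K L (P m)" if "min k (n - k) \<le> m" for m
    unfolding L_def P_def by (rule qcong_qpoch_inf[OF y y]) (use that s in auto)
  have "qcong K (gauss_binomial n k y * L * L) (gauss_binomial n k y * P k * P (n - k))"
    by (intro qcong_mult qcong_refl LP) auto
  also have "gauss_binomial n k y * P k * P (n - k) = P n"
    unfolding P_def by (rule gauss_binomial_prod[OF k])
  also have "qcong K (P n) L" by (rule qcong_sym[OF LP]) (use k in auto)
  finally have "qcong K (gauss_binomial n k y * L * L * recip L) (L * recip L)"
    by (intro qcong_mult qcong_refl)
  then show ?thesis using L unfolding L_def[symmetric] by (simp add: mult.assoc)
qed

subsection \<open>Generating functions\<close>

text \<open>The power of q that a runner r with k beads and its mirror contribute apart from
  inversions, normalised to 0 at charge k - N = 0. As k varies these are the exponents of a theta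
  series.\<close>

definition charge_energy :: "nat \<Rightarrow> nat \<Rightarrow> nat \<Rightarrow> nat \<Rightarrow> int" where
  "charge_energy t N r k =
    int t * (int k - int N)\<^sup>2 + (2 * int r + 1 - int t) * (int k - int N)"

text \<open>The linear coefficient lies strictly between -t and t, so for a nonzero charge c both
  factors of c (t c + 2 r + 1 - t) have the sign of c. Hence \<open>nat\<close> loses nothing in the
  exponents below.\<close>

lemma charge_energy_nonneg:
  assumes "r < t"
  shows "0 \<le> charge_energy t N r k"
proof -
  define c where "c = int k - int N"
  have E: "charge_energy t N r k = c * (int t * c + (2 * int r + 1 - int t))"
    by (simp add: charge_energy_def c_def power2_eq_square algebra_simps)
  consider "c = 0" | "1 \<le> c" | "c \<le> -1" by linarith
  then show ?thesis
  proof cases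
    case 2
    then have "int t * 1 \<le> int t * c" by (intro mult_left_mono) auto
    with 2 show ?thesis unfolding E by (intro mult_nonneg_nonneg) linarith+
  next
    case 3
    then have "int t * c \<le> int t * (-1)" by (intro mult_left_mono) auto
    with 3 assms show ?thesis unfolding E by (intro mult_nonpos_nonpos) linarith+
  qed (simp add: E)
qed

text \<open>The first summand is the power of q in front of a Gaussian binomial, the second the
  precision at which \<open>qcong_gauss_binomial\<close> evaluates it; together they reach N,
  whatever the charge.\<close>

lemma charge_energy_bound:
  assumes r: "r < t" and k: "k \<le> 2 * N"
  shows "N \<le> nat (charge_energy t N r k) + 2 * t * (min k (2 * N - k) + 1)"
proof -
  define d where "d = \<bar>int k - int N\<bar>"
  define m where "m = min k (2 * N - k)"
  have m: "int m = int N - d" using k by (auto simp: m_def d_def)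
  have "- (int t * d) \<le> (2 * int r + 1 - int t) * (int k - int N)"
  proof (cases "int k \<ge> int N")
    case True
    then have "(- int t) * d \<le> (2 * int r + 1 - int t) * d"
      by (intro mult_right_mono) (auto simp: d_def)
    with True show ?thesis by (simp add: d_def)
  next
    case False
    have "(2 * int r + 1 - int t) * d \<le> int t * d"
      using r by (intro mult_right_mono) (auto simp: d_def)
    moreover have "(2 * int r + 1 - int t) * (int k - int N) = - ((2 * int r + 1 - int t) * d)"
      using False unfolding d_def by (simp add: algebra_simps)
    ultimately show ?thesis by linarith
  qed
  moreover have "(int k - int N)\<^sup>2 = d\<^sup>2" by (simp add: d_def)
  ultimately have E: "int t * d\<^sup>2 - int t * d \<le> charge_energy t N r k"
    by (simp add: charge_energy_def)
  \<comment> \<open>With m = N - d, the lower bound t (d^2 - d) for the energy plus 2 t (m + 1)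
    exceeds 2 t N by exactly t (d - 1) (d - 2), which is nonnegative because d is an
    integer.\<close>
  have "0 \<le> (d - 1) * (d - 2)"
  proof (cases "d \<ge> 2")
    case False
    then show ?thesis by (intro mult_nonpos_nonpos) auto
  qed auto
  then have "0 \<le> int t * ((d - 1) * (d - 2))" by simp
  moreover have "int t * ((d - 1) * (d - 2)) + 2 * int t * int N =
      int t * d\<^sup>2 - int t * d + 2 * int t * (int N - d + 1)"
    by (simp add: power2_eq_square algebra_simps)
  moreover have "1 * int N \<le> (2 * int t) * int N" using r by (intro mult_right_mono) auto
  ultimately have "int N \<le> charge_energy t N r k + 2 * int t * (int m + 1)"
    using E unfolding m by linarith
  then have "int N \<le> int (nat (charge_energy t N r k) + 2 * t * (m + 1))"
    using charge_energy_nonneg[OF r, of N k]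
    by (simp add: algebra_simps)
  then show ?thesis unfolding m_def by linarith
qed

text \<open>The joint contribution of the runners r and t - 1 - r if the first one is
  \<open>S\<close>. The mirror doubles the inversions, whence the square of \<open>u\<close> and the
  factor 2 in \<open>2 * t\<close>.\<close>

definition weight :: "coeffs fps \<Rightarrow> nat \<Rightarrow> nat \<Rightarrow> nat \<Rightarrow> nat set \<Rightarrow> coeffs fps" where
  "weight u t N r S = b_pow ((-1) ^ r * (int (card S) - int N)) *
    q_var ^ nat (charge_energy t N r (card S)) * (u ^ 2 * q_var ^ (2 * t)) ^ inversions S"

lemma sum_weight:
  "(\<Sum>S\<in>Pow {..<2 * N}. weight u t N r S) =
    (\<Sum>k\<le>2 * N. b_pow ((-1) ^ r * (int k - int N)) * q_var ^ nat (charge_energy t N r k) *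
      gauss_binomial (2 * N) k (u ^ 2 * q_var ^ (2 * t)))"
proof -
  have "card S \<le> 2 * N" if "S \<in> Pow {..<2 * N}" for S :: "nat set"
    using card_mono[of "{..<2 * N}" S] that by simp
  then have "(\<Sum>S\<in>Pow {..<2 * N}. weight u t N r S) =
      (\<Sum>k\<le>2 * N. \<Sum>S\<in>{S \<in> Pow {..<2 * N}. card S = k}. weight u t N r S)"
    by (intro sum.group[symmetric]) auto
  also have "\<dots> = (\<Sum>k\<le>2 * N. b_pow ((-1) ^ r * (int k - int N)) *
      q_var ^ nat (charge_energy t N r k) * gauss_binomial (2 * N) k (u ^ 2 * q_var ^ (2 * t)))"
    unfolding gauss_binomial_def sum_distrib_left
    by (intro sum.cong) (auto simp: weight_def)
  finally show ?thesis .
qed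

text \<open>The right-hand side does not depend on \<open>u\<close>; comparing \<open>u = x\<close> with \<open>u = 1\<close> makes the
  Jacobi triple product unnecessary.\<close>

lemma qcong_sum_weight:
  fixes u :: "coeffs fps"
  assumes t: "0 < t" and r: "r < t"
  shows "qcong N ((\<Sum>S\<in>Pow {..<2 * N}. weight u t N r S) *
      qpoch_inf (u ^ 2 * q_var ^ (2 * t)) (u ^ 2 * q_var ^ (2 * t)))
    (\<Sum>k\<le>2 * N. b_pow ((-1) ^ r * (int k - int N)) * q_var ^ nat (charge_energy t N r k))"
proof -
  define y where "y = u ^ 2 * q_var ^ (2 * t)"
  have "y = q_var ^ (2 * t) * u ^ 2" by (simp add: y_def mult.commute)
  then have y0: "fps_nth y 0 = 0" using t by (simp only: nth_q_power_mult) simp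
  have "qcong N (b_pow ((-1) ^ r * (int k - int N)) * q_var ^ nat (charge_energy t N r k) *
      gauss_binomial (2 * N) k y * qpoch_inf y y)
    (b_pow ((-1) ^ r * (int k - int N)) * q_var ^ nat (charge_energy t N r k))" if k: "k \<le> 2 * N" for k
  proof -
    define e where "e = nat (charge_energy t N r k)"
    define M where "M = 2 * t * (min k (2 * N - k) + 1)"
    have "y * y ^ min k (2 * N - k) = q_var ^ M * (u ^ 2) ^ (min k (2 * N - k) + 1)"
      unfolding power_Suc[symmetric] y_def M_def
      by (simp only: power_mult_distrib power_mult Suc_eq_plus1 mult.commute)
    then have "qcong M (y * y ^ min k (2 * N - k)) 0"
      by (simp only: qcong_q_power_mult_0 order.refl)
    then have "qcong M (gauss_binomial (2 * N) k y * qpoch_inf y y) 1"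
      by (rule qcong_gauss_binomial[OF y0 k])
    then have "qcong (e + M) (q_var ^ e * (gauss_binomial (2 * N) k y * qpoch_inf y y)) (q_var ^ e * 1)"
      by (rule qcong_q_power_mult)
    then have "qcong N (q_var ^ e * (gauss_binomial (2 * N) k y * qpoch_inf y y)) (q_var ^ e * 1)"
      by (rule qcong_mono) (use charge_energy_bound[OF r k] in \<open>simp only: e_def M_def\<close>)
    then have "qcong N (b_pow ((-1) ^ r * (int k - int N)) *
        (q_var ^ e * (gauss_binomial (2 * N) k y * qpoch_inf y y)))
      (b_pow ((-1) ^ r * (int k - int N)) * (q_var ^ e * 1))"
      by (rule qcong_mult[OF qcong_refl])
    then show ?thesis unfolding e_def[symmetric] by (simp only: mult.assoc mult_1_right)
  qed
  then show ?thesis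
    unfolding sum_weight sum_distrib_right y_def[symmetric] by (intro qcong_sum) simp
qed

section \<open>Size, BG-rank and hooks of a symmetric set as sums over pairs of mirrored
  runners\<close>

lemma card_runner_mirror:
  assumes B: "B \<in> sym_sets (t * N)" and r: "r < t"
  shows "card (runner t (t - 1 - r) B) = 2 * N - card (runner t r B)"
proof -
  let ?S = "runner t r B"
  have sub: "?S \<subseteq> {..<2 * N}" by (rule runner_subset[OF B])
  have "runner t (t - 1 - r) B = (\<lambda>s. 2 * N - 1 - s) ` ({..<2 * N} - ?S)"
    unfolding runner_mirror[OF B r]
  proof (intro equalityI subsetI)
    fix s assume "s \<in> {s. s < 2 * N \<and> 2 * N - 1 - s \<notin> ?S}"
    then show "s \<in> (\<lambda>s. 2 * N - 1 - s) ` ({..<2 * N} - ?S)"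
      by (intro image_eqI[of _ _ "2 * N - 1 - s"]) auto
  qed auto
  moreover have "inj_on (\<lambda>s. 2 * N - 1 - s) ({..<2 * N} - ?S)" by (auto simp: inj_on_def)
  ultimately have "card (runner t (t - 1 - r) B) = card ({..<2 * N} - ?S)"
    by (simp only: card_image)
  also have "\<dots> = 2 * N - card ?S"
    using finite_subset[OF sub] sub by (simp add: card_Diff_subset)
  finally show ?thesis .
qed

lemma inversions_runner_mirror:
  assumes B: "B \<in> sym_sets (t * N)" and r: "r < t"
  shows "inversions (runner t (t - 1 - r) B) = inversions (runner t r B)"
  unfolding runner_mirror[OF B r] by (rule inversions_mirror[OF runner_subset[OF B]])

lemma sum_sym_set_runners:
  fixes f :: "nat \<Rightarrow> 'a::comm_monoid_add"
  assumes B: "B \<in> sym_sets (t * N)" and h: "0 < h" and t: "t = 2 * h"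
  shows "sum f B = (\<Sum>r<h. (\<Sum>s\<in>runner t r B. f (t * s + r)) +
    (\<Sum>s\<in>runner t (t - 1 - r) B. f (t * s + (t - 1 - r))))"
proof -
  have "sum f B = (\<Sum>r<t. \<Sum>s\<in>runner t r B. f (t * s + r))"
    by (rule sum_runner[OF finite_sym_set[OF B]]) (use h t in simp)
  then show ?thesis unfolding t by (simp only: sum_pair_up)
qed

lemma double_sum_lessThan: "2 * int (\<Sum> {..<k}) = int k * (int k - 1)"
  by (induction k) (auto simp: algebra_simps lessThan_Suc)

text \<open>By \<open>sum_eq_inversions\<close> each set contributes its inversions and a triangular
  number. The triangular numbers for k and 2 N - k, together with the residues, make up the
  quadratic polynomial in k - N. The computation is doubled to avoid halving k (k - 1).\<close>

lemma sum_runner_pair: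
  fixes S T :: "nat set"
  assumes S: "finite S" "card S = k" "inversions S = i"
    and T: "finite T" "card T = 2 * N - k" "inversions T = i" and k: "k \<le> 2 * N" and r: "r < t"
  shows "int ((\<Sum>s\<in>S. t * s + r) + (\<Sum>s\<in>T. t * s + (t - 1 - r))) =
    2 * int t * int i + charge_energy t N r k + int N * (int t * int N - 1)"
proof -
  define a b where "a = int (\<Sum> S)" and "b = int (\<Sum> T)"
  have a: "2 * a = 2 * int i + int k * (int k - 1)"
    using sum_eq_inversions[OF S(1)] double_sum_lessThan[of k] S by (simp add: a_def)
  have b: "2 * b = 2 * int i + (2 * int N - int k) * (2 * int N - int k - 1)"
    using sum_eq_inversions[OF T(1)] double_sum_lessThan[of "2 * N - k"] T k by (simp add: b_def of_nat_diff)
  have "(\<Sum>s\<in>S. t * s + r) = t * \<Sum> S + k * r"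
    using S by (simp add: sum.distrib sum_distrib_left)
  moreover have "(\<Sum>s\<in>T. t * s + (t - 1 - r)) = t * \<Sum> T + (2 * N - k) * (t - 1 - r)"
    using T by (simp add: sum.distrib sum_distrib_left)
  ultimately have "int ((\<Sum>s\<in>S. t * s + r) + (\<Sum>s\<in>T. t * s + (t - 1 - r))) =
      int t * a + int k * int r + (int t * b + (2 * int N - int k) * (int t - 1 - int r))" (is "?L = _")
    using k r by (simp add: a_def b_def of_nat_diff)
  then have "2 * ?L = int t * (2 * a) + 2 * int k * int r +
      (int t * (2 * b) + 2 * (2 * int N - int k) * (int t - 1 - int r))"
    by (simp add: algebra_simps)
  also have "\<dots> = 2 * (2 * int t * int i + charge_energy t N r k + int N * (int t * int N - 1))"
    unfolding a b charge_energy_def by (simp add: power2_eq_square algebra_simps)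
  finally show ?thesis by simp
qed

lemma sum_sym_set:
  assumes B: "B \<in> sym_sets (t * N)" and h: "0 < h" and t: "t = 2 * h"
  shows "\<Sum> B = \<Sum> {..<t * N} + (\<Sum>r<h. 2 * t * inversions (runner t r B) +
    nat (charge_energy t N r (card (runner t r B))))"
proof -
  have fin: "finite (runner t r B)" for r
    using runner_subset[OF B] finite_subset by blast
  have k: "card (runner t r B) \<le> 2 * N" for r
    using card_mono[OF _ runner_subset[OF B, of r]] by simp
  have "int (\<Sum> B) = (\<Sum>r<h. int ((\<Sum>s\<in>runner t r B. t * s + r) +
    (\<Sum>s\<in>runner t (t - 1 - r) B. t * s + (t - 1 - r))))"
    by (simp only: sum_sym_set_runners[OF B h t] of_nat_sum)
  also have "\<dots> = (\<Sum>r<h. int (2 * t * inversions (runner t r B) +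
    nat (charge_energy t N r (card (runner t r B)))) + int N * (int t * int N - 1))"
  proof (rule sum.cong[OF refl])
    fix r assume "r \<in> {..<h}"
    then have r: "r < t" using t by simp
    show "int ((\<Sum>s\<in>runner t r B. t * s + r) +
        (\<Sum>s\<in>runner t (t - 1 - r) B. t * s + (t - 1 - r))) =
      int (2 * t * inversions (runner t r B) +
        nat (charge_energy t N r (card (runner t r B)))) + int N * (int t * int N - 1)"
      using sum_runner_pair[OF fin refl refl fin card_runner_mirror[OF B r]
          inversions_runner_mirror[OF B r] k r]
        charge_energy_nonneg[OF r, of N "card (runner t r B)"] by simp
  qed
  also have "\<dots> = int (\<Sum>r<h. 2 * t * inversions (runner t r B) +
    nat (charge_energy t N r (card (runner t r B)))) + int h * (int N * (int t * int N - 1))"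
    by (subst sum.distrib) (simp only: of_nat_sum sum_constant card_lessThan)
  \<comment> \<open>The constants of the h pairs add up to t N (t N - 1) / 2, the element sum of the
    beta-set of the empty partition.\<close>
  also have "int h * (int N * (int t * int N - 1)) = int (\<Sum> {..<t * N})"
    using double_sum_lessThan[of "t * N"] t by (simp add: algebra_simps)
  finally show ?thesis by linarith
qed

text \<open>For even t the sign is constant on each runner and opposite on its mirror, so a pair
  with k and 2 N - k beads contributes (-1)^r (k - (2 N - k)).\<close>

lemma alternating_sum_sym_set:
  assumes B: "B \<in> sym_sets (t * N)" and h: "0 < h" and t: "t = 2 * h"
  shows "(\<Sum>x\<in>B. (-1) ^ x) = 2 * (\<Sum>r<h. (-1) ^ r * (int (card (runner t r B)) - int N))"
proof -
  have "(\<Sum>x\<in>B. (-1::int) ^ x) = (\<Sum>r<h. (\<Sum>s\<in>runner t r B. (-1) ^ (t * s + r)) +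
    (\<Sum>s\<in>runner t (t - 1 - r) B. (-1) ^ (t * s + (t - 1 - r))))"
    by (rule sum_sym_set_runners[OF B h t])
  also have "\<dots> = (\<Sum>r<h. 2 * ((-1) ^ r * (int (card (runner t r B)) - int N)))"
  proof (rule sum.cong[OF refl])
    fix r assume "r \<in> {..<h}"
    then have r: "r < t" using t by simp
    have ev: "(-1::int) ^ (t * s + m) = (-1) ^ m" for s m
      using t by (simp add: power_add power_mult)
    have "Suc (t - 1 - r) + r = t" using r by simp
    then have "(-1::int) ^ (Suc (t - 1 - r) + r) = 1" using t by (simp add: power_mult)
    then have odd: "(-1::int) ^ (t - 1 - r) = - ((-1) ^ r)"
      by (cases "even r") (simp_all add: power_add)
    have "card (runner t r B) \<le> 2 * N"
      using card_mono[OF _ runner_subset[OF B, of r]] by simp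
    then have c: "int (card (runner t (t - 1 - r) B)) = 2 * int N - int (card (runner t r B))"
      unfolding card_runner_mirror[OF B r] by simp
    show "(\<Sum>s\<in>runner t r B. (-1) ^ (t * s + r)) +
        (\<Sum>s\<in>runner t (t - 1 - r) B. (-1) ^ (t * s + (t - 1 - r))) =
      2 * ((-1) ^ r * (int (card (runner t r B)) - int N))"
      unfolding ev odd sum_constant c by (simp add: algebra_simps)
  qed
  finally show ?thesis by (simp add: sum_distrib_left)
qed

lemma inversions_mod_sym_set:
  assumes B: "B \<in> sym_sets (t * N)" and h: "0 < h" and t: "t = 2 * h"
  shows "card {(x, y). x \<in> B \<and> y < x \<and> y \<notin> B \<and> t dvd x - y} =
    (\<Sum>r<h. 2 * inversions (runner t r B))"
proof -
  have "card {(x, y). x \<in> B \<and> y < x \<and> y \<notin> B \<and> t dvd x - y} =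
      (\<Sum>r<2 * h. inversions (runner t r B))"
    using card_inversions_mod[OF finite_sym_set[OF B], of t] h t by simp
  also have "\<dots> = (\<Sum>r<h. inversions (runner t r B) + inversions (runner t (t - 1 - r) B))"
    unfolding sum_pair_up t ..
  also have "\<dots> = (\<Sum>r<h. 2 * inversions (runner t r B))"
    by (rule sum.cong[OF refl]) (use inversions_runner_mirror[OF B] t in simp)
  finally show ?thesis .
qed

lemma prod_b_pow: "(\<Prod>r\<in>A. b_pow (f r)) = b_pow (\<Sum>r\<in>A. f r)"
  by (induction A rule: infinite_finite_induct) (auto simp: b_pow_0 b_pow_add)

lemma term_eq_prod_weight:
  assumes l: "l \<in> self_conjugate" and n: "length l \<le> t * N" and h: "0 < h" and t: "t = 2 * h"
  shows "q_var ^ sum_list l * u ^ size (hooks_div t l) * b_pow (BG_rank l) =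
    (\<Prod>r<h. weight u t N r (runner t r (beta_set (t * N) l)))"
proof -
  define B where "B = beta_set (t * N) l"
  define i where "i r = inversions (runner t r B)" for r
  define e where "e r = nat (charge_energy t N r (card (runner t r B)))" for r
  have B: "B \<in> sym_sets (t * N)" unfolding B_def by (rule beta_set_in_sym_sets[OF l n])
  have p: "is_partition l" using l by (simp add: self_conjugate_iff)
  have m: "part l 1 \<le> t * N" using part_1_self_conjugate[OF l] n by simp
  have 1: "sum_list l = (\<Sum>r<h. 2 * t * i r + e r)"
    using sum_list_eq_beta_set[OF p n] sum_sym_set[OF B h t]
    unfolding B_def[symmetric] i_def e_def by linarith
  have 2: "size (hooks_div t l) = (\<Sum>r<h. 2 * i r)"
    unfolding size_hooks_div[OF p n m] B_def[symmetric] i_def by (rule inversions_mod_sym_set[OF B h t])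
  have 3: "BG_rank l = (\<Sum>r<h. (-1) ^ r * (int (card (runner t r B)) - int N))"
    using BG_rank_beta_set[OF p n] alternating_sum_sym_set[OF B h t] t
    unfolding B_def[symmetric] by simp
  show ?thesis
    unfolding 1 2 3 prod_b_pow[symmetric] power_sum prod.distrib[symmetric] B_def[symmetric]
  proof (rule prod.cong[OF refl])
    fix r
    have "(u ^ 2 * q_var ^ (2 * t)) ^ i r = u ^ (2 * i r) * q_var ^ (2 * t * i r)"
      by (simp only: power_mult_distrib power_mult)
    then show "q_var ^ (2 * t * i r + e r) * u ^ (2 * i r) *
        b_pow ((-1) ^ r * (int (card (runner t r B)) - int N)) = weight u t N r (runner t r B)"
      unfolding weight_def i_def[symmetric] e_def[symmetric] by (simp add: power_add mult_ac)
  qed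
qed

lemma sum_eq_prod_sum_weight:
  assumes h: "0 < h" and t: "t = 2 * h"
  shows "(\<Sum>l\<in>{l \<in> self_conjugate. length l \<le> t * N}.
      q_var ^ sum_list l * u ^ size (hooks_div t l) * b_pow (BG_rank l)) =
    (\<Prod>r<h. \<Sum>S\<in>Pow {..<2 * N}. weight u t N r S)"
proof -
  have "(\<Sum>l\<in>{l \<in> self_conjugate. length l \<le> t * N}.
      q_var ^ sum_list l * u ^ size (hooks_div t l) * b_pow (BG_rank l)) =
    (\<Sum>l\<in>{l \<in> self_conjugate. length l \<le> t * N}.
      \<Prod>r<h. weight u t N r (runner t r (beta_set (t * N) l)))"
    by (rule sum.cong[OF refl]) (use term_eq_prod_weight[OF _ _ h t] in auto)
  also have "\<dots> = (\<Sum>B\<in>sym_sets (t * N). \<Prod>r<h. weight u t N r (runner t r B))"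
    by (rule sum.reindex_bij_betw[OF bij_betw_beta_set])
  \<comment> \<open>\<open>restrict\<close> leaves the values at r < h alone; it makes the family of
    runners extensional, as an element of \<open>PiE\<close> must be.\<close>
  also have "\<dots> = (\<Sum>B\<in>sym_sets (t * N).
      \<Prod>r<h. weight u t N r (restrict (\<lambda>r. runner t r B) {..<h} r))"
    by simp
  also have "\<dots> = (\<Sum>g\<in>PiE {..<h} (\<lambda>_. Pow {..<2 * N}). \<Prod>r<h. weight u t N r (g r))"
    by (rule sum.reindex_bij_betw[OF bij_betw_runners[OF h t]])
  also have "\<dots> = (\<Prod>r<h. \<Sum>S\<in>Pow {..<2 * N}. weight u t N r S)"
    by (rule prod_sum_PiE[symmetric]) auto
  finally show ?thesis .
qed

section \<open>The case x = 1: symmetric sets described by their upper half\<close>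

lemma sym_set_decompose:
  assumes B: "B \<in> sym_sets n"
  shows "B = (\<lambda>d. n + d) ` {d. n + d \<in> B} \<union> (\<lambda>d. n - 1 - d) ` ({..<n} - {d. n + d \<in> B})"
    (is "_ = ?f ` ?D \<union> ?g ` ?E")
proof (intro equalityI subsetI)
  have mir: "2 * n - 1 - x \<in> B \<longleftrightarrow> x \<notin> B" if "x < 2 * n" for x
    using B that unfolding sym_sets_def by blast
  fix x
  {
    assume x: "x \<in> B"
    show "x \<in> ?f ` ?D \<union> ?g ` ?E"
    proof (cases "n \<le> x")
      case True
      with x have "x = ?f (x - n)" "x - n \<in> ?D" by auto
      then show ?thesis by blast
    next
      case False
      then have "2 * n - 1 - x \<notin> B" using mir[of x] x by auto
      moreover have "2 * n - 1 - x = n + (n - 1 - x)" using False by auto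
      ultimately have "n - 1 - x \<in> ?E" using False by auto
      moreover have "x = ?g (n - 1 - x)" using False by auto
      ultimately show ?thesis by blast
    qed
  }
  assume "x \<in> ?f ` ?D \<union> ?g ` ?E"
  then consider "x \<in> B" | d where "d < n" "n + d \<notin> B" "x = n - 1 - d" by auto
  then show "x \<in> B"
  proof cases
    case 2
    then have "2 * n - 1 - (n + d) \<in> B" using mir[of "n + d"] by simp
    moreover have "2 * n - 1 - (n + d) = x" using 2 by simp
    ultimately show ?thesis by simp
  qed
qed

lemma sum_sym_set_halves:
  fixes f :: "nat \<Rightarrow> 'a::comm_monoid_add"
  assumes B: "B \<in> sym_sets n"
  shows "sum f B = (\<Sum>d | n + d \<in> B. f (n + d)) + (\<Sum>d\<in>{..<n} - {d. n + d \<in> B}. f (n - 1 - d))"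
proof -
  let ?D = "{d. n + d \<in> B}"
  let ?E = "{..<n} - ?D"
  have D: "?D \<subseteq> {..<n}" using B by (auto simp: sym_sets_def)
  have finD: "finite ?D" by (rule finite_subset[OF D]) simp
  have "sum f B = sum f ((\<lambda>d. n + d) ` ?D \<union> (\<lambda>d. n - 1 - d) ` ?E)"
    by (rule arg_cong[OF sym_set_decompose[OF B]])
  also have "\<dots> = sum f ((\<lambda>d. n + d) ` ?D) + sum f ((\<lambda>d. n - 1 - d) ` ?E)"
    by (rule sum.union_disjoint) (use finD in auto)
  also have "sum f ((\<lambda>d. n + d) ` ?D) = (\<Sum>d\<in>?D. f (n + d))"
    by (subst sum.reindex) (auto simp: inj_on_def)
  also have "sum f ((\<lambda>d. n - 1 - d) ` ?E) = (\<Sum>d\<in>?E. f (n - 1 - d))"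
    by (subst sum.reindex) (auto simp: inj_on_def)
  finally show ?thesis .
qed

lemma bij_betw_sym_sets_Pow: "bij_betw (\<lambda>B. {d. n + d \<in> B}) (sym_sets n) (Pow {..<n})"
proof (rule bij_betw_byWitness[where
      f' = "\<lambda>D. (\<lambda>d. n + d) ` D \<union> (\<lambda>d. n - 1 - d) ` ({..<n} - D)"])
  show "\<forall>B\<in>sym_sets n. (\<lambda>d. n + d) ` {d. n + d \<in> B} \<union>
      (\<lambda>d. n - 1 - d) ` ({..<n} - {d. n + d \<in> B}) = B"
    using sym_set_decompose by blast
  show "\<forall>D\<in>Pow {..<n}. {d. n + d \<in> (\<lambda>d. n + d) ` D \<union> (\<lambda>d. n - 1 - d) ` ({..<n} - D)} = D"
    by auto
  show "(\<lambda>B. {d. n + d \<in> B}) ` sym_sets n \<subseteq> Pow {..<n}"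
    by (auto simp: sym_sets_def)
  show "(\<lambda>D. (\<lambda>d. n + d) ` D \<union> (\<lambda>d. n - 1 - d) ` ({..<n} - D)) ` Pow {..<n} \<subseteq> sym_sets n"
  proof
    fix B assume "B \<in> (\<lambda>D. (\<lambda>d. n + d) ` D \<union> (\<lambda>d. n - 1 - d) ` ({..<n} - D)) ` Pow {..<n}"
    then obtain D where D: "D \<subseteq> {..<n}"
      and B: "B = (\<lambda>d. n + d) ` D \<union> (\<lambda>d. n - 1 - d) ` ({..<n} - D)" by blast
    have hi: "n + d \<in> B \<longleftrightarrow> d \<in> D" for d by (auto simp: B)
    have lo: "n - 1 - d \<in> B \<longleftrightarrow> d \<notin> D" if "d < n" for d
    proof
      assume "n - 1 - d \<in> B"
      moreover have "n - 1 - d \<noteq> n + x" for x using that by linarith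
      ultimately obtain d' where "d' < n" "d' \<notin> D" "n - 1 - d = n - 1 - d'" by (auto simp: B)
      moreover from this that have "d = d'" by linarith
      ultimately show "d \<notin> D" by simp
    qed (use that in \<open>auto simp: B\<close>)
    show "B \<in> sym_sets n"
      unfolding sym_sets_def
    proof (intro CollectI conjI allI impI)
      show "B \<subseteq> {..<2 * n}" using D by (auto simp: B)
      fix x assume x: "x < 2 * n"
      show "2 * n - 1 - x \<in> B \<longleftrightarrow> x \<notin> B"
      proof (cases "n \<le> x")
        case True
        define d where "d = x - n"
        have "d < n" "x = n + d" "2 * n - 1 - x = n - 1 - d" using True x by (auto simp: d_def)
        then show ?thesis using hi[of d] lo[of d] by simp
      next
        case False
        define d where "d = n - 1 - x"
        have "d < n" "x = n - 1 - d" "2 * n - 1 - x = n + d" using False by (auto simp: d_def)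
        then show ?thesis using hi[of d] lo[of d] by simp
      qed
    qed
  qed
qed

text \<open>A bead n + d belongs to a row that meets the diagonal, and its mirror n - 1 - d is the
  gap of the corresponding column; so d encodes a diagonal hook of length 2 d + 1. Such a hook has
  BG-rank (-1)^d. This is the classical bijection with partitions into distinct odd parts, hence an
  exact finite product.\<close>

lemma sum_self_conjugate_BG_rank:
  assumes "even n"
  shows "(\<Sum>l\<in>{l \<in> self_conjugate. length l \<le> n}. q_var ^ sum_list l * b_pow (BG_rank l)) =
    (\<Prod>d<n. b_pow ((-1) ^ d) * q_var ^ (2 * d + 1) + 1)"
proof -
  have summand: "q_var ^ sum_list l * b_pow (BG_rank l) =
      (\<Prod>d\<in>{d. n + d \<in> beta_set n l}. b_pow ((-1) ^ d) * q_var ^ (2 * d + 1))"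
    if l: "l \<in> self_conjugate" and n: "length l \<le> n" for l
  proof -
    have p: "is_partition l" using l by (simp add: self_conjugate_iff)
    define B where "B = beta_set n l"
    have B: "B \<in> sym_sets n" unfolding B_def by (rule beta_set_in_sym_sets[OF l n])
    define D where "D = {d. n + d \<in> B}"
    have D: "D \<subseteq> {..<n}" using B by (auto simp: sym_sets_def D_def)
    have split: "sum f {..<n} = sum f D + sum f ({..<n} - D)" for f :: "nat \<Rightarrow> 'b::comm_monoid_add"
      using sum.subset_diff[OF D, of f] by (simp add: add.commute)
    have "\<Sum> B = (\<Sum>d\<in>D. n + d) + (\<Sum>d\<in>{..<n} - D. n - 1 - d)"
      unfolding D_def by (rule sum_sym_set_halves[OF B])
    \<comment> \<open>Writing n + d as its mirror plus 2 d + 1 completes the sum over the complement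
      of \<open>D\<close> to a sum over all d < n, which belongs to the empty partition and
      cancels.\<close>
    also have "(\<Sum>d\<in>D. n + d) = (\<Sum>d\<in>D. (n - 1 - d) + (2 * d + 1))"
      by (rule sum.cong[OF refl]) (use D in auto)
    also have "\<dots> = (\<Sum>d\<in>D. n - 1 - d) + (\<Sum>d\<in>D. 2 * d + 1)"
      by (rule sum.distrib)
    finally have "\<Sum> B = (\<Sum>d<n. n - 1 - d) + (\<Sum>d\<in>D. 2 * d + 1)"
      unfolding split by simp
    also have "(\<Sum>d<n. n - 1 - d) = \<Sum> {..<n}"
      using sum.nat_diff_reindex[of "\<lambda>d. d" n] by simp
    finally have 1: "sum_list l = (\<Sum>d\<in>D. 2 * d + 1)"
      using sum_list_eq_beta_set[OF p n] by (simp add: B_def)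
    have "(\<Sum>x\<in>B. (-1::int) ^ x) = (\<Sum>d\<in>D. (-1) ^ (n + d)) + (\<Sum>d\<in>{..<n} - D. (-1) ^ (n - 1 - d))"
      unfolding D_def by (rule sum_sym_set_halves[OF B])
    also have "(\<Sum>d\<in>D. (-1::int) ^ (n + d)) = (\<Sum>d\<in>D. (-1) ^ d)"
      using assms by (simp add: power_add)
    also have "(\<Sum>d\<in>{..<n} - D. (-1::int) ^ (n - 1 - d)) = (\<Sum>d\<in>{..<n} - D. - ((-1) ^ d))"
    proof (rule sum.cong[OF refl])
      fix d assume "d \<in> {..<n} - D"
      then have "even (n - 1 - d) \<longleftrightarrow> odd d" using assms by auto
      then show "(-1::int) ^ (n - 1 - d) = - ((-1) ^ d)" by (cases "even d") auto
    qed
    finally have "(\<Sum>x\<in>B. (-1::int) ^ x) = 2 * (\<Sum>d\<in>D. (-1) ^ d) - (\<Sum>d<n. (-1) ^ d)"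
      unfolding split by (simp add: sum_negf)
    moreover have "(\<Sum>d<n. (-1::int) ^ d) = 0"
      using assms by (induction n rule: induct_nat_012) auto
    ultimately have 2: "BG_rank l = (\<Sum>d\<in>D. (-1) ^ d)"
      using BG_rank_beta_set[OF p n assms] by (simp add: B_def)
    show ?thesis
      unfolding 1 2 power_sum prod_b_pow[symmetric] B_def[symmetric] D_def[symmetric]
      by (simp add: mult.commute flip: prod.distrib)
  qed
  have "(\<Sum>l\<in>{l \<in> self_conjugate. length l \<le> n}. q_var ^ sum_list l * b_pow (BG_rank l)) =
    (\<Sum>l\<in>{l \<in> self_conjugate. length l \<le> n}.
      \<Prod>d\<in>{d. n + d \<in> beta_set n l}. b_pow ((-1) ^ d) * q_var ^ (2 * d + 1))"
    by (rule sum.cong[OF refl]) (use summand in auto)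
  also have "\<dots> = (\<Sum>B\<in>sym_sets n. \<Prod>d\<in>{d. n + d \<in> B}. b_pow ((-1) ^ d) * q_var ^ (2 * d + 1))"
    by (rule sum.reindex_bij_betw[OF bij_betw_beta_set])
  also have "\<dots> = (\<Sum>D\<in>Pow {..<n}. \<Prod>d\<in>D. b_pow ((-1) ^ d) * q_var ^ (2 * d + 1))"
    by (rule sum.reindex_bij_betw[OF bij_betw_sym_sets_Pow])
  also have "\<dots> = (\<Prod>d<n. b_pow ((-1) ^ d) * q_var ^ (2 * d + 1) + 1)"
    by (subst prod_add) auto
  finally show ?thesis .
qed

text \<open>Even d = 2 j gives the factor 1 + b q^(4j+1), odd d = 2 j + 1 the factor 1 + q^(4j+3) /
  b.\<close>

lemma prod_split_parity:
  "(\<Prod>d<2 * m. b_pow ((-1) ^ d) * q_var ^ (2 * d + 1) + 1) =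
    (\<Prod>j<m. 1 - (- b_pow 1 * q_var) * (q_var ^ 4) ^ j) *
    (\<Prod>j<m. 1 - (- b_pow (-1) * q_var ^ 3) * (q_var ^ 4) ^ j)"
proof (induction m)
  case (Suc m)
  have 1: "q_var ^ (2 * (2 * m) + 1) = q_var * (q_var ^ 4) ^ m"
    by (simp flip: power_mult)
  have "2 * Suc (2 * m) + 1 = 3 + 4 * m" by simp
  then have 2: "q_var ^ (2 * Suc (2 * m) + 1) = q_var ^ 3 * (q_var ^ 4) ^ m"
    by (simp only: power_add power_mult)
  have "(\<Prod>d<2 * Suc m. b_pow ((-1) ^ d) * q_var ^ (2 * d + 1) + 1) =
    (\<Prod>d<2 * m. b_pow ((-1) ^ d) * q_var ^ (2 * d + 1) + 1) *
    (b_pow ((-1) ^ (2 * m)) * q_var ^ (2 * (2 * m) + 1) + 1) *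
    (b_pow ((-1) ^ Suc (2 * m)) * q_var ^ (2 * Suc (2 * m) + 1) + 1)"
    by (simp del: power_Suc)
  also have "b_pow ((-1) ^ (2 * m)) * q_var ^ (2 * (2 * m) + 1) + 1 =
    1 - (- b_pow 1 * q_var) * (q_var ^ 4) ^ m"
    unfolding 1 by (simp add: mult.assoc)
  also have "b_pow ((-1) ^ Suc (2 * m)) * q_var ^ (2 * Suc (2 * m) + 1) + 1 =
    1 - (- b_pow (-1) * q_var ^ 3) * (q_var ^ 4) ^ m"
    unfolding 2 by (simp add: mult.assoc)
  finally show ?case unfolding Suc.IH by (simp add: mult_ac)
qed simp

text \<open>Only finitely many terms reach below a given power of q, so each coefficient of the
  finite partial sums is eventually constant.\<close>

lemma qcong_infsum:
  fixes w :: "'a \<Rightarrow> nat" and g :: "'a \<Rightarrow> coeffs fps"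
  assumes fin: "\<And>K. finite {a \<in> A. w a < K}"
    and F: "finite F" "F \<subseteq> A" "{a \<in> A. w a < K} \<subseteq> F"
  shows "qcong K (\<Sum>\<^sub>\<infinity>a\<in>A. q_var ^ w a * g a) (\<Sum>a\<in>F. q_var ^ w a * g a)"
proof -
  define f where "f a = q_var ^ w a * g a" for a
  define L where "L = Abs_fps (\<lambda>k. \<Sum>a\<in>{a \<in> A. w a < Suc k}. fps_nth (f a) k)"
  have eq: "fps_nth (sum f Y) k = fps_nth L k"
    if "finite Y" "Y \<subseteq> A" "{a \<in> A. w a < Suc k} \<subseteq> Y" for Y k
  proof -
    have "fps_nth (f a) k = 0" if "\<not> w a < Suc k" for a
      using that by (simp add: f_def nth_q_power_mult)
    then have "(\<Sum>a\<in>Y. fps_nth (f a) k) = (\<Sum>a\<in>{a \<in> A. w a < Suc k}. fps_nth (f a) k)"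
      using that by (intro sum.mono_neutral_right) auto
    then show ?thesis by (simp add: L_def fps_sum_nth)
  qed
  \<comment> \<open>Establishes summability as well; otherwise \<open>infsum\<close> would be its
    default value 0.\<close>
  have "(f has_sum L) A"
    unfolding has_sum_def
  proof (rule tendsto_fpsI)
    fix k
    show "\<forall>\<^sub>F Y in finite_subsets_at_top A. fps_nth (sum f Y) k = fps_nth L k"
      unfolding eventually_finite_subsets_at_top
      using fin[of "Suc k"] eq by (intro exI[of _ "{a \<in> A. w a < Suc k}"]) auto
  qed
  then have "infsum f A = L" by (rule infsumI)
  moreover have "qcong K L (sum f F)"
    unfolding qcong_def
  proof (intro allI impI)
    fix k assume "k < K"
    with F(3) have "{a \<in> A. w a < Suc k} \<subseteq> F" by auto
    with eq[OF F(1,2)] show "fps_nth L k = fps_nth (sum f F) k" by simp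
  qed
  ultimately show ?thesis by (simp add: f_def[abs_def])
qed

lemma finite_self_conjugate_length: "finite {l \<in> self_conjugate. length l \<le> n}"
proof -
  have "finite (sym_sets n)"
    by (rule finite_subset[of _ "Pow {..<2 * n}"]) (auto simp: sym_sets_def)
  then show ?thesis using bij_betw_finite[OF bij_betw_beta_set] by blast
qed

lemma length_le_sum_list:
  assumes "is_partition l"
  shows "length l \<le> sum_list l"
proof -
  have "\<forall>p\<in>set l. 0 < p" using assms by (simp add: is_partition_def)
  then show ?thesis by (induction l) auto
qed

theorem mainTheorem5:
  fixes t :: nat
  assumes "0 < t" and "even t"
  shows "(\<Sum>\<^sub>\<infinity>l\<in>self_conjugate. q_var ^ sum_list l * x_var ^ size (hooks_div t l) * b_pow (BG_rank l)) =
    qpoch_inf (q_var ^ (2 * t)) (q_var ^ (2 * t)) ^ (t div 2) *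
    recip (qpoch_inf (x_var ^ 2 * q_var ^ (2 * t)) (x_var ^ 2 * q_var ^ (2 * t)) ^ (t div 2)) *
    qpoch_inf (- b_pow 1 * q_var) (q_var ^ 4) *
    qpoch_inf (- b_pow (-1) * q_var ^ 3) (q_var ^ 4)"
proof -
  define h where "h = t div 2"
  have t: "t = 2 * h" and h: "0 < h" using assms by (auto simp: h_def)
  define P where "P u = qpoch_inf (u ^ 2 * q_var ^ (2 * t)) (u ^ 2 * q_var ^ (2 * t)) ^ h"
    for u :: "coeffs fps"
  define G where "G = (\<Sum>\<^sub>\<infinity>l\<in>self_conjugate.
    q_var ^ sum_list l * x_var ^ size (hooks_div t l) * b_pow (BG_rank l))"
  define R1 where "R1 = qpoch_inf (- b_pow 1 * q_var) (q_var ^ 4)"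
  define R2 where "R2 = qpoch_inf (- b_pow (-1) * q_var ^ 3) (q_var ^ 4)"
  have small: "K \<le> m \<Longrightarrow> qcong K (c * q_var ^ m) 0" for K m c
    using qcong_q_power_mult_0[of K m c] by (simp add: mult.commute)
  have nth0: "fps_nth (c * q_var ^ m) 0 = 0" if "0 < m" for c m
    using small[of 1 m c] that by (simp add: qcong_def)
  \<comment> \<open>For each N the congruences modulo q^N run through G P(x), T(x) P(x), C, T(1)
    P(1) and R1 R2 P(1).\<close>
  have "G * P x_var = R1 * R2 * P 1"
  proof (rule qcong_eqI)
    fix N
    define F where "F = {l \<in> self_conjugate. length l \<le> t * N}"
    define T where "T u = (\<Sum>l\<in>F. q_var ^ sum_list l * u ^ size (hooks_div t l) * b_pow (BG_rank l))"
      for u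
    \<comment> \<open>A truncated product of theta series that is never evaluated; it only links u =
      x with u = 1.\<close>
    define C where "C = (\<Prod>r<h. \<Sum>k\<le>2 * N. b_pow ((-1) ^ r * (int k - int N)) *
      q_var ^ nat (charge_energy t N r k))"
    have len: "length l \<le> sum_list l" if "l \<in> self_conjugate" for l
      using length_le_sum_list[of l] that by (simp add: self_conjugate_iff)
    have NtN: "N \<le> t * N" using assms(1) by simp
    \<comment> \<open>A partition has at most as many parts as its size, so those of length up to t
      N include all of size below N.\<close>
    have sub: "{l \<in> self_conjugate. sum_list l < N} \<subseteq> F"
    proof
      fix l assume "l \<in> {l \<in> self_conjugate. sum_list l < N}"
      then have l: "l \<in> self_conjugate" "sum_list l < N" by auto
      have "length l \<le> t * N" using len[OF l(1)] l(2) NtN by linarith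
      with l show "l \<in> F" by (simp add: F_def)
    qed
    have "finite {l \<in> self_conjugate. sum_list l < K}" for K
      by (rule finite_subset[OF _ finite_self_conjugate_length[of K]]) (auto dest: len)
    moreover have "finite F" "F \<subseteq> self_conjugate"
      using finite_self_conjugate_length by (auto simp: F_def)
    ultimately have "qcong N G (T x_var)"
      unfolding G_def T_def mult.assoc using sub by (intro qcong_infsum)
    then have 1: "qcong N (G * P x_var) (T x_var * P x_var)"
      by (intro qcong_mult qcong_refl)
    have 2: "qcong N (T u * P u) C" for u
    proof -
      have "T u * P u = (\<Prod>r<h. (\<Sum>S\<in>Pow {..<2 * N}. weight u t N r S) *
          qpoch_inf (u ^ 2 * q_var ^ (2 * t)) (u ^ 2 * q_var ^ (2 * t)))"
        unfolding T_def F_def P_def sum_eq_prod_sum_weight[OF h t] by (simp add: prod.distrib)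
      also have "qcong N \<dots> C"
        unfolding C_def by (intro qcong_prod qcong_sum_weight) (use assms(1) t in auto)
      finally show ?thesis .
    qed
    \<comment> \<open>At u = 1 the truncated sum is an exact product over d < t N = 2 h N, with h N
      factors of each parity.\<close>
    have "T 1 = (\<Prod>j<h * N. 1 - (- b_pow 1 * q_var) * (q_var ^ 4) ^ j) *
      (\<Prod>j<h * N. 1 - (- b_pow (-1) * q_var ^ 3) * (q_var ^ 4) ^ j)"
      using sum_self_conjugate_BG_rank[of "t * N"] prod_split_parity[of "h * N"] t
      unfolding T_def F_def by (simp add: mult.assoc)
    moreover have "N \<le> h * N" using h by simp
    \<comment> \<open>The omitted factors, those with j at least h N, differ from 1 by a multiple of
      q^N.\<close>
    then have le: "N \<le> 3 + 4 * j" "N \<le> 1 + 4 * j" if "h * N \<le> j" for j using that by linarith+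
    have q3: "- b_pow (-1) * q_var ^ 3 * (q_var ^ 4) ^ j = - b_pow (-1) * q_var ^ (3 + 4 * j)" for j
      by (simp only: power_add power_mult mult.assoc)
    have q1: "- b_pow 1 * q_var * (q_var ^ 4) ^ j = - b_pow 1 * q_var ^ (1 + 4 * j)" for j
      by (simp only: power_add power_mult mult.assoc power_one_right)
    have "qcong N R1 (\<Prod>j<h * N. 1 - (- b_pow 1 * q_var) * (q_var ^ 4) ^ j)"
      unfolding R1_def
      by (rule qcong_qpoch_inf)
        (use nth0[of 1 "- b_pow 1"] nth0[of 4 1] in \<open>auto simp only: q1 intro: small le\<close>, simp_all)
    moreover have "qcong N R2 (\<Prod>j<h * N. 1 - (- b_pow (-1) * q_var ^ 3) * (q_var ^ 4) ^ j)"
      unfolding R2_def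
      by (rule qcong_qpoch_inf)
        (use nth0[of 3 "- b_pow (-1)"] nth0[of 4 1] in \<open>auto simp only: q3 intro: small le\<close>, simp_all)
    ultimately have "qcong N (T 1) (R1 * R2)"
      by (simp only:) (intro qcong_sym[OF qcong_mult])
    then have 3: "qcong N (T 1 * P 1) (R1 * R2 * P 1)"
      by (intro qcong_mult qcong_refl)
    show "qcong N (G * P x_var) (R1 * R2 * P 1)"
      using qcong_trans[OF 1 qcong_trans[OF 2 qcong_trans[OF qcong_sym[OF 2] 3]]] .
  qed
  moreover have "fps_nth (P x_var) 0 = 1"
  proof -
    have y: "fps_nth (x_var ^ 2 * q_var ^ (2 * t)) 0 = 0" by (rule nth0) (use assms(1) in simp)
    show ?thesis unfolding P_def by (simp add: fps_power_zeroth qpoch_inf_LIMSEQ(2)[OF y y])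
  qed
  then have "P x_var * recip (P x_var) = 1" by (rule mult_recip)
  ultimately have "G = R1 * R2 * P 1 * recip (P x_var)"
    by (metis mult.assoc mult_1_right)
  moreover have "P 1 = qpoch_inf (q_var ^ (2 * t)) (q_var ^ (2 * t)) ^ h" by (simp add: P_def)
  ultimately show ?thesis
    unfolding G_def R1_def R2_def P_def h_def by (simp only: mult_ac)
qed

end
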